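(* Let $\Phi\subseteq V^*$ be an essential root system all of whose irreducible components are of classical type ($\mathrm A$, $\mathrm B$, $\mathrm C$ or $\mathrm D$), with root lattice $\mathcal L\subseteq V^*$. Let $g:\mathcal L\to\mathbb R\cup\{+\infty\}$ be an M-convex function of type $\Phi$ and $p\in\operatorname{dom} g$. Then $p\in\operatorname{argmin} g$ if and only if $g(p)\le g(p+\alpha)$ for all $\alpha\in\Phi$.
   Context: Root systems. $V$ is a finite-dimensional real inner product space with dual $V^*$, $\langle p,x\rangle=p(x)$ for $p\in V^*,x\in V$; $V^*$ carries the induced inner product. For $\alpha\in V^*\setminus\{0\}$, $\alpha^\vee\in V$ is $2/\|\alpha\|^2$ times the vector of $V$ representing $\alpha$, and $s_\alpha(p)=p-\langle p,\alpha^\vee\rangle\alpha$. A root system is a nonempty finite set $\Phi\subseteq V^*\setminus\{0\}$ with $s_\alpha(\beta)\in\Phi$, $\mathbb R\alpha\cap\Phi=\{\alpha,-\alpha\}$ and $\langle\alpha,\beta^\vee\rangle\in\mathbb Z$ for all $\alpha,\beta\in\Phi$. It is essential if $\operatorname{span}\Phi=V^*$; it decomposes uniquely into mutually orthogonal irreducible components. The root lattice $\mathcal L$ is the set of integer linear combinations of roots. Convexity notions. For a closed convex $P\subseteq V^*$ and $p\in P$, $\mathrm T_p(P)=\operatorname{cl}(\operatorname{cone}\{q-p:q\in P\})$ is the tangent cone. An M-convex cone of type $\Phi$ is a cone $\operatorname{cone}\Phi'$ with $\Phi'\subseteq\Phi$ ($\operatorname{cone}\emptyset=\{0\}$). An M-convex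 polyhedron of type $\Phi$ is a nonempty closed convex set $P\subseteq V^*$ such that $\mathrm T_p(P)$ is an M-convex cone for all $p\in P$ (such $P$ is a polyhedron); it is integral if $P=\operatorname{conv}(P\cap\mathcal L)$. A convex set is locally polyhedral if its intersection with every polytope is a polytope; a function is locally polyhedral convex if its epigraph is a locally polyhedral convex set. For a function $h$ on $V^*$, $\Pi(h)=\{\operatorname{argmin}(h-x): x\in V,\ \operatorname{argmin}(h-x)\neq\emptyset\}$, where $(h-x)(p)=h(p)-\langle p,x\rangle$. A primal-integral locally polyhedral M-convex function of type $\Phi$ is a proper locally polyhedral convex function $\hat g:V^*\to\mathbb R\cup\{+\infty\}$ such that every member of $\Pi(\hat g)$ is an integral M-convex polyhedron of type $\Phi$. A function $g:\mathcal L\to\mathbb R\cup\{+\infty\}$ is M-convex of type $\Phi$ if it is the restriction to $\mathcal L$ of some such $\hat g$. $\operatorname{dom} g$ is the set where $g$ is finite. *)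

theory Defs
  imports "HOL-Analysis.Analysis"
begin

text \<open>
  Throughout, the Euclidean space \<open>'a\<close> plays the role of \<open>V\<^sup>*\<close>, and \<open>V\<close> is identified with \<open>'a\<close>
  by means of the inner product (Riesz representation): the pairing of \<open>p \<in> V\<^sup>*\<close> and \<open>x \<in> V\<close> is
  \<open>p \<bullet> x\<close>.
\<close>

section \<open>Root systems\<close>

definition coroot :: "'a::euclidean_space \<Rightarrow> 'a" where
  "coroot \<alpha> = (2 / (norm \<alpha>)\<^sup>2) *\<^sub>R \<alpha>"

definition reflection :: "'a::euclidean_space \<Rightarrow> 'a \<Rightarrow> 'a" where
  "reflection \<alpha> p = p - (p \<bullet> coroot \<alpha>) *\<^sub>R \<alpha>"

definition root_system :: "'a::euclidean_space set \<Rightarrow> bool" where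
  "root_system \<Phi> \<longleftrightarrow>
     finite \<Phi> \<and> \<Phi> \<noteq> {} \<and> 0 \<notin> \<Phi> \<and>
     (\<forall>\<alpha>\<in>\<Phi>. \<forall>\<beta>\<in>\<Phi>. reflection \<alpha> \<beta> \<in> \<Phi>) \<and>
     (\<forall>\<alpha>\<in>\<Phi>. span {\<alpha>} \<inter> \<Phi> = {\<alpha>, - \<alpha>}) \<and>
     (\<forall>\<alpha>\<in>\<Phi>. \<forall>\<beta>\<in>\<Phi>. \<alpha> \<bullet> coroot \<beta> \<in> \<int>)"

definition essential :: "'a::euclidean_space set \<Rightarrow> bool" where
  "essential \<Phi> \<longleftrightarrow> span \<Phi> = UNIV"

definition root_lattice :: "'a::euclidean_space set \<Rightarrow> 'a set" where
  "root_lattice \<Phi> = {(\<Sum>\<alpha>\<in>\<Phi>. of_int (c \<alpha>) *\<^sub>R \<alpha>) | c :: 'a \<Rightarrow> int. True}"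

definition irreducible_root_system :: "'a::euclidean_space set \<Rightarrow> bool" where
  "irreducible_root_system \<Psi> \<longleftrightarrow>
     root_system \<Psi> \<and>
     \<not> (\<exists>A B. A \<noteq> {} \<and> B \<noteq> {} \<and> A \<union> B = \<Psi> \<and> (\<forall>\<alpha>\<in>A. \<forall>\<beta>\<in>B. \<alpha> \<bullet> \<beta> = 0))"

definition irreducible_components :: "'a::euclidean_space set \<Rightarrow> 'a set set" where
  "irreducible_components \<Phi> =
     {\<Psi>. \<Psi> \<subseteq> \<Phi> \<and> irreducible_root_system \<Psi> \<and> (\<forall>\<alpha>\<in>\<Psi>. \<forall>\<beta>\<in>\<Phi> - \<Psi>. \<alpha> \<bullet> \<beta> = 0)}"

subsection \<open>Classical types\<close>

text \<open>
  The standard models live in \<open>\<real>\<^sup>m\<close>, whose vectors are represented as functions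
  \<open>nat \<Rightarrow> real\<close> vanishing outside \<open>{..<m}\<close>; here \<open>m = n + 1\<close> for type \<open>A\<^sub>n\<close> and \<open>m = n\<close> otherwise.
\<close>

definition eps :: "nat \<Rightarrow> nat \<Rightarrow> real" where
  "eps i k = of_bool (k = i)"

definition dot :: "nat \<Rightarrow> (nat \<Rightarrow> real) \<Rightarrow> (nat \<Rightarrow> real) \<Rightarrow> real" where
  "dot m x y = (\<Sum>k<m. x k * y k)"

definition A_roots :: "nat \<Rightarrow> (nat \<Rightarrow> real) set" where
  "A_roots n = {(\<lambda>k. eps i k - eps j k) | i j. i < n + 1 \<and> j < n + 1 \<and> i \<noteq> j}"

definition D_roots :: "nat \<Rightarrow> (nat \<Rightarrow> real) set" where
  "D_roots n = {(\<lambda>k. s * eps i k + t * eps j k) | s t i j.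
     s \<in> {1, -1} \<and> t \<in> {1, -1} \<and> i < j \<and> j < n}"

definition B_roots :: "nat \<Rightarrow> (nat \<Rightarrow> real) set" where
  "B_roots n = D_roots n \<union> {(\<lambda>k. s * eps i k) | s i. s \<in> {1, -1} \<and> i < n}"

definition C_roots :: "nat \<Rightarrow> (nat \<Rightarrow> real) set" where
  "C_roots n = D_roots n \<union> {(\<lambda>k. 2 * s * eps i k) | s i. s \<in> {1, -1} \<and> i < n}"

text \<open>
  Isomorphism of root systems: a linear bijection of the spans that maps \<open>\<Psi>\<close> onto \<open>M\<close> and
  preserves all Cartan integers; \<open>f\<close> need not be isometric.
\<close>

definition isomorphic_to_model ::
    "'a::euclidean_space set \<Rightarrow> nat \<Rightarrow> (nat \<Rightarrow> real) set \<Rightarrow> bool" where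
  "isomorphic_to_model \<Psi> m M \<longleftrightarrow>
     (\<exists>f :: 'a \<Rightarrow> nat \<Rightarrow> real.
        (\<forall>k. linear (\<lambda>p. f p k)) \<and> inj_on f (span \<Psi>) \<and> f ` \<Psi> = M \<and>
        (\<forall>\<alpha>\<in>\<Psi>. \<forall>\<beta>\<in>\<Psi>. \<alpha> \<bullet> coroot \<beta> = 2 * dot m (f \<alpha>) (f \<beta>) / dot m (f \<beta>) (f \<beta>)))"

definition classical_type :: "'a::euclidean_space set \<Rightarrow> bool" where
  "classical_type \<Psi> \<longleftrightarrow>
     (\<exists>n\<ge>1. isomorphic_to_model \<Psi> (n + 1) (A_roots n)) \<or>
     (\<exists>n\<ge>2. isomorphic_to_model \<Psi> n (B_roots n)) \<or>
     (\<exists>n\<ge>3. isomorphic_to_model \<Psi> n (C_roots n)) \<or>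
     (\<exists>n\<ge>4. isomorphic_to_model \<Psi> n (D_roots n))"

section \<open>M-convexity\<close>

definition tangent_cone :: "'a::euclidean_space \<Rightarrow> 'a set \<Rightarrow> 'a set" where
  "tangent_cone p P = closure (convex_cone hull {q - p | q. q \<in> P})"

definition M_convex_cone :: "'a::euclidean_space set \<Rightarrow> 'a set \<Rightarrow> bool" where
  "M_convex_cone \<Phi> K \<longleftrightarrow> (\<exists>\<Phi>'\<subseteq>\<Phi>. K = convex_cone hull \<Phi>')"

definition M_convex_polyhedron :: "'a::euclidean_space set \<Rightarrow> 'a set \<Rightarrow> bool" where
  "M_convex_polyhedron \<Phi> P \<longleftrightarrow>
     P \<noteq> {} \<and> closed P \<and> convex P \<and> (\<forall>p\<in>P. M_convex_cone \<Phi> (tangent_cone p P))"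

definition integral_set :: "'a::euclidean_space set \<Rightarrow> 'a set \<Rightarrow> bool" where
  "integral_set \<Phi> P \<longleftrightarrow> P = convex hull (P \<inter> root_lattice \<Phi>)"

definition locally_polyhedral :: "'a::euclidean_space set \<Rightarrow> bool" where
  "locally_polyhedral S \<longleftrightarrow> convex S \<and> (\<forall>Q. polytope Q \<longrightarrow> polytope (S \<inter> Q))"

definition proper :: "('a \<Rightarrow> ereal) \<Rightarrow> bool" where
  "proper h \<longleftrightarrow> (\<forall>p. h p \<noteq> -\<infinity>) \<and> (\<exists>p. h p \<noteq> \<infinity>)"

definition ereal_epigraph :: "('a \<Rightarrow> ereal) \<Rightarrow> ('a \<times> real) set" where
  "ereal_epigraph h = {(p, t). h p \<le> ereal t}"

definition locally_polyhedral_convex_fun :: "('a::euclidean_space \<Rightarrow> ereal) \<Rightarrow> bool" where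
  "locally_polyhedral_convex_fun h \<longleftrightarrow> locally_polyhedral (ereal_epigraph h)"

definition argmin_on :: "'a set \<Rightarrow> ('a \<Rightarrow> ereal) \<Rightarrow> 'a set" where
  "argmin_on S h = {p \<in> S. \<forall>q\<in>S. h p \<le> h q}"

definition dom_on :: "'a set \<Rightarrow> ('a \<Rightarrow> ereal) \<Rightarrow> 'a set" where
  "dom_on S h = {p \<in> S. \<bar>h p\<bar> \<noteq> \<infinity>}"

definition argmin_family :: "('a::euclidean_space \<Rightarrow> ereal) \<Rightarrow> 'a set set" where
  "argmin_family h =
     {argmin_on UNIV (\<lambda>p. h p - ereal (p \<bullet> x)) | x.
        argmin_on UNIV (\<lambda>p. h p - ereal (p \<bullet> x)) \<noteq> {}}"

definition primal_integral_M_convex ::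
    "'a::euclidean_space set \<Rightarrow> ('a \<Rightarrow> ereal) \<Rightarrow> bool" where
  "primal_integral_M_convex \<Phi> h \<longleftrightarrow>
     proper h \<and> locally_polyhedral_convex_fun h \<and>
     (\<forall>P\<in>argmin_family h. M_convex_polyhedron \<Phi> P \<and> integral_set \<Phi> P)"

text \<open>
  A function on the root lattice is represented by a function on the whole space; its values
  outside the lattice are irrelevant. The value \<open>-\<infinity>\<close> is excluded on the lattice because the
  extension is proper.
\<close>

definition M_convex_fun :: "'a::euclidean_space set \<Rightarrow> ('a \<Rightarrow> ereal) \<Rightarrow> bool" where
  "M_convex_fun \<Phi> g \<longleftrightarrow>
     (\<exists>h. primal_integral_M_convex \<Phi> h \<and> (\<forall>p\<in>root_lattice \<Phi>. g p = h p))"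

end

theory Submission
  imports Defs
begin

text \<open>
  Only the direction from local to global optimality has content. Let \<open>h\<close> be the convex extension
  of \<open>g\<close>, and suppose \<open>h q < h p\<close>. Near \<open>p\<close> the epigraph of \<open>h\<close> is polyhedral, so some affine
  minorant of \<open>h\<close> is tight both at \<open>p\<close> and at a point \<open>r\<close> of the segment from \<open>p\<close> to \<open>q\<close> close to \<open>p\<close>,
  where \<open>h r < h p\<close> (\<open>linear_descent_piece\<close>). Its tight set \<open>P\<close> is an integral M-convex polyhedron
  on which \<open>h\<close> is affine, which reduces the theorem to linear optimization over \<open>P\<close>: if no root \<open>\<beta>\<close>
  with \<open>p + \<beta> \<in> P\<close> increases a linear functional \<open>c\<close>, then \<open>p\<close> maximizes \<open>c\<close> over \<open>P\<close>
  (\<open>root_neighbours_suffice\<close>).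

  The tangent cone of \<open>P\<close> at \<open>p\<close> is generated by roots, and it is enough to show that each such
  generator \<open>\<alpha>\<close> is a nonnegative combination of roots \<open>\<beta>\<close> with \<open>p + \<beta> \<in> P\<close>. Let \<open>\<alpha>\<close> lie in the
  irreducible component \<open>\<Psi>\<close>, and use coordinates on \<open>span \<Psi>\<close> in which the roots have the form
  \<open>s e\<^sub>i + t e\<^sub>j\<close> with \<open>s, t \<in> {-1, 0, 1}\<close>. Every functional decomposes into its level sets, which are
  sign vectors \<open>x \<in> {-1, 0, 1}\<^sup>m\<close>, and the decomposition respects nonpositivity on roots. Hence
  \<open>p + \<alpha> \<notin> P\<close> is always witnessed by a sign vector \<open>x\<close> whose slack
  \<open>max\<^sub>P x - x p\<close>, an integer by integrality of \<open>P\<close>, is smaller than \<open>x \<alpha>\<close>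
  (\<open>missing_neighbour_blocked\<close>). Slack \<open>0\<close> is impossible when \<open>\<alpha>\<close> is tangent and \<open>x \<alpha> > 0\<close>, and
  \<open>x \<alpha> \<le> 2\<close>; so the slack is \<open>1\<close> and \<open>x \<alpha> = 2\<close>, that is \<open>x\<^sub>i = s\<close> and \<open>x\<^sub>j = t\<close>.

  Slack is bisubmodular: \<open>x + y\<close> is the sum of a meet and a join of sign vectors, and on every root
  the values of these two cannot have opposite signs, so both are maximized where \<open>x + y\<close> is
  (\<open>bisubmodular\<close>). It follows that no sign vector \<open>y\<close> of slack \<open>0\<close> has \<open>y\<^sub>i = s\<close> or \<open>y\<^sub>j = t\<close>. Then
  \<open>2 s e\<^sub>i\<close> is a sum of two roots \<open>\<beta>\<close> with \<open>p + \<beta> \<in> P\<close>, and likewise for \<open>2 t e\<^sub>j\<close>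
  (\<open>free_direction\<close>). For type B the root \<open>s e\<^sub>i\<close> serves; in type A the situation does not arise, as
  constant sign vectors vanish on roots. In types C and D coordinate sums on the lattice are even, so
  a sign vector of slack \<open>1\<close> with \<open>x\<^sub>i = s\<close> and maximal support misses some coordinate \<open>k\<close>, and
  \<open>s e\<^sub>i + e\<^sub>k\<close> and \<open>s e\<^sub>i - e\<^sub>k\<close> serve, because a sign vector blocking either of them would allow the support to
  grow. Adding up, \<open>2 \<alpha>\<close> is a sum of four roots leading from \<open>p\<close> into \<open>P\<close>.
\<close>

section \<open>Descent along a linear piece of a locally polyhedral convex function\<close>

lemma frequently_bex_finite:
  assumes "finite F" "eventually (\<lambda>x. \<exists>H\<in>F. Q H x) net" "net \<noteq> bot"
  shows "\<exists>H\<in>F. frequently (Q H) net"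
proof (rule ccontr)
  assume "\<not> (\<exists>H\<in>F. frequently (Q H) net)"
  then have "eventually (\<lambda>x. \<forall>H\<in>F. \<not> Q H x) net"
    using assms(1) by (intro eventually_ball_finite) (auto simp: frequently_def)
  with assms(2) have "eventually (\<lambda>x. False) net" by eventually_elim blast
  with assms(3) show False by simp
qed

text \<open>
  At a point of a polyhedron that has no points of the polyhedron closely below it in the vertical
  direction, one of the finitely many defining halfspaces is tight and bounds that direction from below.
\<close>
lemma polytope_tight_halfspace_below:
  fixes K :: "('a::euclidean_space \<times> real) set"
  assumes F: "finite F" "K = \<Inter>F" "\<And>H. H \<in> F \<Longrightarrow> H = {z. A H \<bullet> z \<le> B H}"
    and z: "(r, y) \<in> K" and low: "eventually (\<lambda>e. (r, y - e) \<notin> K) (at_right 0)"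
  shows "\<exists>H\<in>F. snd (A H) < 0 \<and> A H \<bullet> (r, y) = B H"
proof (rule ccontr)
  assume no: "\<not> ?thesis"
  have "eventually (\<lambda>e. \<forall>H\<in>F. (r, y - e) \<in> H) (at_right 0)"
  proof (rule eventually_ball_finite[OF F(1)], rule ballI)
    fix H assume H: "H \<in> F"
    obtain A1 A2 where A: "A H = (A1, A2)" by (cases "A H")
    have AB: "(u, v) \<in> H \<longleftrightarrow> A1 \<bullet> u + A2 * v \<le> B H" for u v by (subst F(3)[OF H]) (simp add: A)
    have le: "A1 \<bullet> r + A2 * y \<le> B H" using z F(2) H AB by auto
    show "eventually (\<lambda>e. (r, y - e) \<in> H) (at_right 0)"
    proof (cases "A2 < 0")
      case False
      have "eventually (\<lambda>e::real. e > 0) (at_right 0)" by (rule eventually_at_right_less)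
      then show ?thesis
      proof eventually_elim
        case (elim e)
        have "A2 * e \<ge> 0" using elim False by simp
        then show ?case using le unfolding AB by (simp add: algebra_simps)
      qed
    next
      case True
      have "A H \<bullet> (r, y) \<noteq> B H" using no H True A by auto
      then have lt: "A1 \<bullet> r + A2 * y < B H" using le A by simp
      have "((\<lambda>e. A1 \<bullet> r + A2 * (y - e)) \<longlongrightarrow> A1 \<bullet> r + A2 * (y - 0)) (at_right 0)"
        by (intro tendsto_intros)
      then have "eventually (\<lambda>e. A1 \<bullet> r + A2 * (y - e) < B H) (at_right 0)"
        using lt by (intro order_tendstoD(2)) simp_all
      then show ?thesis by eventually_elim (simp add: AB)
    qed
  qed
  with low have "eventually (\<lambda>e::real. False) (at_right 0)"
    by eventually_elim (use F(2) in blast)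
  then show False by simp
qed

text \<open>
  A point that does not minimize \<open>h\<close> shares a cell \<open>argmin (h - x)\<close> with a point of smaller value. The proof
  follows the graph of \<open>h\<close> along a segment towards \<open>p\<close>: infinitely many of the points share one
  tight halfspace of the polyhedral epigraph, which is therefore tight at \<open>p\<close> too.
\<close>
lemma linear_descent_piece:
  fixes h :: "'a::euclidean_space \<Rightarrow> ereal"
  assumes lp: "locally_polyhedral_convex_fun h" and noninf: "\<And>u. h u \<noteq> -\<infinity>"
    and hp: "h p = ereal a" and hq: "h q < h p"
  shows "\<exists>x r. p \<in> argmin_on UNIV (\<lambda>u. h u - ereal (u \<bullet> x)) \<and>
               r \<in> argmin_on UNIV (\<lambda>u. h u - ereal (u \<bullet> x)) \<and> h r < h p"
proof -
  define E where "E = ereal_epigraph h"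
  have E: "(u, t) \<in> E \<longleftrightarrow> h u \<le> ereal t" for u t by (simp add: E_def ereal_epigraph_def)
  have convE: "convex E" and polyE: "\<And>Q. polytope Q \<Longrightarrow> polytope (E \<inter> Q)"
    using lp unfolding locally_polyhedral_convex_fun_def locally_polyhedral_def E_def by auto
  obtain b where b: "h q = ereal b" using noninf[of q] hq by (cases "h q") auto
  have ba: "b < a" using hq hp b by simp
  define Q where "Q = cbox ((p, a) - One) ((p, a) + One)"
  have "(p, a) \<in> box ((p, a) - One) ((p, a) + One)" by (auto simp: mem_box inner_simps)
  then obtain \<delta> where \<delta>: "\<delta> > 0" "ball (p, a) \<delta> \<subseteq> Q"
    unfolding Q_def by (meson open_box open_contains_ball box_subset_cbox subset_trans)
  define K where "K = E \<inter> Q"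
  have "polytope K" unfolding K_def Q_def by (intro polyE polytope_interval)
  then have closedK: "closed K" and "polyhedron K"
    by (auto intro: polytope_imp_closed polytope_imp_polyhedron)
  then obtain F where F: "finite F" "K = \<Inter>F" and "\<forall>H\<in>F. \<exists>A B. A \<noteq> 0 \<and> H = {z. A \<bullet> z \<le> B}"
    unfolding polyhedron_def by blast
  then obtain A B where AB: "\<And>H. H \<in> F \<Longrightarrow> H = {z. A H \<bullet> z \<le> B H}" by metis
  define t where "t n = inverse (real (Suc n))" for n
  have t: "0 < t n" "t n \<le> 1" for n by (auto simp: t_def divide_simps)
  have t0: "t \<longlonglongrightarrow> 0" unfolding t_def by (rule LIMSEQ_inverse_real_of_nat)
  define r where "r n = (1 - t n) *\<^sub>R p + t n *\<^sub>R q" for n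
  have "(\<lambda>n. (1 - t n) *\<^sub>R p + t n *\<^sub>R q) \<longlonglongrightarrow> (1 - 0) *\<^sub>R p + 0 *\<^sub>R q"
    by (intro tendsto_intros t0)
  then have r: "r \<longlonglongrightarrow> p" by (simp add: r_def[abs_def])
  have hr: "h (r n) < ereal a" for n
  proof -
    have "(1 - t n) *\<^sub>R (p, a) + t n *\<^sub>R (q, b) \<in> E"
      using t[of n] by (intro convexD[OF convE]) (auto simp: E hp b)
    then have "h (r n) \<le> ereal ((1 - t n) * a + t n * b)" by (simp add: E r_def)
    also have "(1 - t n) * a + t n * b < a"
      using mult_strict_left_mono[OF ba t(1)[of n]] by (simp add: algebra_simps)
    finally show ?thesis by simp
  qed
  define y where "y n = real_of_ereal (h (r n))" for n
  have hy: "h (r n) = ereal (y n)" for n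
    unfolding y_def using hr[of n] noninf[of "r n"] by (cases "h (r n)") auto
  have ya: "y n < a" for n using hr[of n] by (simp add: hy)
  \<comment> \<open>Convexity gives the upper bound; the lower bound is lower semicontinuity, from closedness of \<open>K\<close>.\<close>
  have y: "y \<longlonglongrightarrow> a"
  proof (rule order_tendstoI)
    fix c assume "a < c"
    then show "eventually (\<lambda>n. y n < c) sequentially"
      using ya by (intro always_eventually) (meson order.strict_trans)
  next
    fix c assume c: "c < a"
    define c' where "c' = max c (a - \<delta> / 2)"
    have c': "c \<le> c'" "c' < a" "a - \<delta> < c'" using c \<delta>(1) by (auto simp: c'_def max_def)
    have lim: "(\<lambda>n. (r n, c')) \<longlonglongrightarrow> (p, c')" by (intro tendsto_intros r)
    have "(p, c') \<notin> K" unfolding K_def using c' by (simp add: E hp)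
    then have 1: "eventually (\<lambda>n. (r n, c') \<in> - K) sequentially"
      using closedK by (intro topological_tendstoD[OF lim]) auto
    have "(p, c') \<in> ball (p, a) \<delta>" using c' by (simp add: dist_Pair_Pair dist_real_def)
    then have 2: "eventually (\<lambda>n. (r n, c') \<in> ball (p, a) \<delta>) sequentially"
      by (intro topological_tendstoD[OF lim]) auto
    from 1 2 show "eventually (\<lambda>n. c < y n) sequentially"
    proof eventually_elim
      case (elim n)
      then have "(r n, c') \<notin> E" using \<delta>(2) by (auto simp: K_def)
      then have "c' < y n" by (simp add: E hy)
      then show ?case using c'(1) by simp
    qed
  qed
  have lim: "(\<lambda>n. (r n, y n)) \<longlonglongrightarrow> (p, a)" by (intro tendsto_intros r y)
  have "eventually (\<lambda>n. (r n, y n) \<in> ball (p, a) \<delta>) sequentially"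
    using \<delta>(1) by (intro topological_tendstoD[OF lim]) auto
  then have "eventually (\<lambda>n. \<exists>H\<in>F. snd (A H) < 0 \<and> A H \<bullet> (r n, y n) = B H) sequentially"
  proof eventually_elim
    case (elim n)
    then have inK: "(r n, y n) \<in> K" using \<delta>(2) by (auto simp: K_def E hy)
    have "eventually (\<lambda>e::real. e > 0) (at_right 0)" by (rule eventually_at_right_less)
    then have "eventually (\<lambda>e. (r n, y n - e) \<notin> K) (at_right 0)"
      by eventually_elim (simp add: K_def E hy)
    with F AB inK show ?case by (rule polytope_tight_halfspace_below[where A = A and B = B])
  qed
  from frequently_bex_finite[OF F(1) this]
  obtain H where H: "H \<in> F"
    "frequently (\<lambda>n. snd (A H) < 0 \<and> A H \<bullet> (r n, y n) = B H) sequentially"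
    by auto
  obtain n where n: "snd (A H) < 0" "A H \<bullet> (r n, y n) = B H"
    using frequently_ex[OF H(2)] by blast
  have tight: "A H \<bullet> (p, a) = B H"
  proof (rule ccontr)
    assume "A H \<bullet> (p, a) \<noteq> B H"
    then have "eventually (\<lambda>n. (r n, y n) \<in> - {z. A H \<bullet> z = B H}) sequentially"
      using closed_hyperplane[of "A H" "B H"] by (intro topological_tendstoD[OF lim]) auto
    then show False using H(2) by (auto simp: frequently_def elim: eventually_mono)
  qed
  obtain A1 A2 where A12: "A H = (A1, A2)" by (cases "A H")
  have A2: "A2 < 0" using n(1) A12 by simp
  \<comment> \<open>Near \<open>(p, a)\<close> the halfspace contains the epigraph by construction; convexity of the epigraph
    and tightness at \<open>(p, a)\<close> make this global.\<close>
  have global: "A1 \<bullet> u + A2 * v \<le> B H" if "(u, v) \<in> E" for u v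
  proof -
    define d where "d = (u, v) - (p, a)"
    define e where "e = \<delta> / (\<delta> + norm d)"
    have "\<delta> + norm d > 0" using \<delta>(1) by (simp add: add_pos_nonneg)
    then have e: "0 < e" "e \<le> 1" "e * norm d < \<delta>"
      using \<delta>(1) by (auto simp: e_def field_simps)
    have "(1 - e) *\<^sub>R (p, a) + e *\<^sub>R (u, v) \<in> E"
      using e that by (intro convexD[OF convE]) (auto simp: E hp)
    also have "(1 - e) *\<^sub>R (p, a) + e *\<^sub>R (u, v) = (p, a) + e *\<^sub>R d"
      by (simp add: d_def algebra_simps)
    finally have 1: "(p, a) + e *\<^sub>R d \<in> E" .
    have "dist (p, a) ((p, a) + e *\<^sub>R d) < \<delta>" using e by (simp add: dist_norm)
    then have "(p, a) + e *\<^sub>R d \<in> K" using 1 \<delta>(2) by (auto simp: K_def)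
    then have "(p, a) + e *\<^sub>R d \<in> H" using F(2) H(1) by blast
    then have "A H \<bullet> ((p, a) + e *\<^sub>R d) \<le> B H" using AB[OF H(1)] by blast
    then have "e * (A H \<bullet> d) \<le> 0" using tight by (simp add: inner_add_right)
    then have "A H \<bullet> d \<le> 0" using e(1) by (simp add: mult_le_0_iff)
    then show ?thesis using tight by (simp add: d_def A12 inner_diff_right algebra_simps)
  qed
  define x where "x = (- 1 / A2) *\<^sub>R A1"
  have val: "v - u \<bullet> x = (A1 \<bullet> u + A2 * v) / A2" for u v
    using A2 by (simp add: x_def inner_commute field_simps)
  have lower: "ereal (B H / A2) \<le> h u - ereal (u \<bullet> x)" for u
  proof (cases "h u")
    case (real v)
    then have "A1 \<bullet> u + A2 * v \<le> B H" by (intro global) (simp add: E)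
    then show ?thesis using A2 by (simp add: real val divide_right_mono_neg)
  qed (use noninf in auto)
  have "h p - ereal (p \<bullet> x) = ereal (B H / A2)" using tight by (simp add: hp val A12)
  moreover have "h (r n) - ereal (r n \<bullet> x) = ereal (B H / A2)" using n(2) by (simp add: hy val A12)
  ultimately show ?thesis
    using lower hr[of n] hp by (intro exI[of _ x] exI[of _ "r n"]) (auto simp: argmin_on_def)
qed

section \<open>Level decomposition\<close>

text \<open>
  The level of a real number at height \<open>t > 0\<close>: its sign if its absolute value is at least \<open>t\<close>, and \<open>0\<close>
  otherwise. A real number is the integral over \<open>t > 0\<close> of its levels.
\<close>
definition level :: "real \<Rightarrow> real \<Rightarrow> int" where
  "level t c = (if c \<ge> t then 1 else if c \<le> - t then -1 else 0)"

text \<open>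
  A linear form that is positive at a coefficient vector is positive at one of its level vectors.
  The induction peels off the lowest level, which cancels the coefficients of least absolute value.
\<close>
lemma level_positive:
  fixes c a :: "nat \<Rightarrow> real"
  assumes "(\<Sum>k<m. c k * a k) > 0"
  shows "\<exists>t>0. (\<Sum>k<m. of_int (level t (c k)) * a k) > 0"
  using assms
proof (induction "card {k. k < m \<and> c k \<noteq> 0}" arbitrary: c rule: less_induct)
  case less
  let ?N = "{k. k < m \<and> c k \<noteq> 0}"
  have ne: "?N \<noteq> {}"
  proof
    assume "?N = {}"
    then have "(\<Sum>k<m. c k * a k) = 0" by (intro sum.neutral) auto
    with less.prems show False by simp
  qed
  define t where "t = Min ((\<lambda>k. \<bar>c k\<bar>) ` ?N)"
  have fin: "finite ((\<lambda>k. \<bar>c k\<bar>) ` ?N)" by simp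
  have "t \<in> (\<lambda>k. \<bar>c k\<bar>) ` ?N" unfolding t_def by (rule Min_in) (use ne in auto)
  then obtain l where l: "l < m" "c l \<noteq> 0" "t = \<bar>c l\<bar>" by auto
  have tpos: "t > 0" using l by simp
  have tle: "t \<le> \<bar>c k\<bar>" if "k < m" "c k \<noteq> 0" for k
    unfolding t_def using that fin by (intro Min_le) auto
  show ?case
  proof (cases "(\<Sum>k<m. of_int (level t (c k)) * a k) > 0")
    case True
    with tpos show ?thesis by blast
  next
    case False
    define c' where "c' k = c k - t * of_int (level t (c k))" for k
    have "(\<Sum>k<m. c' k * a k)
        = (\<Sum>k<m. c k * a k) - t * (\<Sum>k<m. of_int (level t (c k)) * a k)"
      by (simp add: c'_def algebra_simps sum_subtractf sum_distrib_left)
    moreover have "t * (\<Sum>k<m. of_int (level t (c k)) * a k) \<le> 0"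
      using False tpos by (simp add: mult_le_0_iff)
    ultimately have pos: "(\<Sum>k<m. c' k * a k) > 0" using less.prems by linarith
    have zero: "c' k = 0" if "c k = 0" for k
      using that tpos by (simp add: c'_def level_def)
    have "c' l = 0" using l tpos by (auto simp: c'_def level_def abs_if split: if_splits)
    then have "{k. k < m \<and> c' k \<noteq> 0} \<subset> ?N" using zero l by auto
    then have "card {k. k < m \<and> c' k \<noteq> 0} < card ?N" by (intro psubset_card_mono) auto
    from less.hyps[OF this pos] obtain u where u: "u > 0"
      "(\<Sum>k<m. of_int (level u (c' k)) * a k) > 0" by blast
    have "level u (c' k) = level (t + u) (c k)" if "k < m" for k
    proof (cases "c k = 0")
      case True
      then show ?thesis using zero[OF True] u tpos by (simp add: level_def)
    next
      case False
      then show ?thesis using tle[OF that False] u tpos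
        by (auto simp: c'_def level_def abs_if split: if_splits)
    qed
    then have "(\<Sum>k<m. of_int (level (t + u) (c k)) * a k) > 0" using u by simp
    then show ?thesis using u tpos by (intro exI[of _ "t + u"]) auto
  qed
qed

section \<open>Sign vectors\<close>

text \<open>
  Sign vectors have integer entries \<open>-1\<close>, \<open>0\<close>, \<open>1\<close>; they are total functions on \<open>nat\<close>, and only the
  entries below the number of coordinates matter.
\<close>
definition sign_vector :: "(nat \<Rightarrow> int) \<Rightarrow> bool" where
  "sign_vector x \<longleftrightarrow> (\<forall>k. x k \<in> {-1, 0, 1})"

text \<open>
  The join of two sign vectors is their union, except that conflicting entries cancel to \<open>0\<close>; the meet
  is their common part. By construction \<open>meet x y + join x y = x + y\<close>.
\<close>
definition join :: "(nat \<Rightarrow> int) \<Rightarrow> (nat \<Rightarrow> int) \<Rightarrow> nat \<Rightarrow> int" where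
  "join x y k = sgn (x k + y k)"

definition meet :: "(nat \<Rightarrow> int) \<Rightarrow> (nat \<Rightarrow> int) \<Rightarrow> nat \<Rightarrow> int" where
  "meet x y k = x k + y k - sgn (x k + y k)"

lemma sign_vectorD: "sign_vector x \<Longrightarrow> x k = -1 \<or> x k = 0 \<or> x k = 1"
  by (auto simp: sign_vector_def)

lemma sign_vector_join: "sign_vector (join x y)"
  by (auto simp: sign_vector_def join_def sgn_if)

lemma join_bounds: "join x y k \<in> {-1, 0, 1}"
  by (auto simp: join_def sgn_if)

lemma meet_eq_0_or_join:
  assumes "sign_vector x" "sign_vector y"
  shows "meet x y k = 0 \<or> meet x y k = join x y k"
  using sign_vectorD[OF assms(1), of k] sign_vectorD[OF assms(2), of k]
  by (auto simp: meet_def join_def)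

lemma sign_vector_meet:
  assumes "sign_vector x" "sign_vector y"
  shows "sign_vector (meet x y)"
  using meet_eq_0_or_join[OF assms] join_bounds[of x y] unfolding sign_vector_def by (metis insertCI)

text \<open>
  A meet agrees with the join wherever it is not zero, so a root \<open>s e\<^sub>i + t e\<^sub>j\<close> never separates them:
  if their sum is nonpositive on the root, so is each of them.
\<close>
lemma join_meet_conformal:
  assumes "sign_vector x" "sign_vector y" "s \<in> {-1, 0, 1::int}" "t \<in> {-1, 0, 1}"
    and "s * meet x y i + t * meet x y j + (s * join x y i + t * join x y j) \<le> 0"
  shows "s * meet x y i + t * meet x y j \<le> 0 \<and> s * join x y i + t * join x y j \<le> 0"
proof -
  define a b where "a = s * join x y i" and "b = t * join x y j"
  have "-1 \<le> a" "a \<le> 1" using join_bounds[of x y i] assms(3) by (auto simp: a_def)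
  moreover have "-1 \<le> b" "b \<le> 1" using join_bounds[of x y j] assms(4) by (auto simp: b_def)
  moreover have "s * meet x y i = 0 \<or> s * meet x y i = a" "t * meet x y j = 0 \<or> t * meet x y j = b"
    using meet_eq_0_or_join[OF assms(1,2)] unfolding a_def b_def by (metis mult_zero_right)+
  moreover have "s * meet x y i + t * meet x y j + (a + b) \<le> 0"
    using assms(5) unfolding a_def b_def .
  ultimately show ?thesis unfolding a_def[symmetric] b_def[symmetric] by linarith
qed

section \<open>Classical coordinates\<close>

text \<open>
  The functional, as a vector, with coefficients \<open>x\<close> in the coordinate functionals \<open>w 0, \<dots>, w (m - 1)\<close>.
\<close>
definition signed_sum :: "nat \<Rightarrow> (nat \<Rightarrow> 'a::euclidean_space) \<Rightarrow> (nat \<Rightarrow> int) \<Rightarrow> 'a" where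
  "signed_sum m w x = (\<Sum>k<m. of_int (x k) *\<^sub>R w k)"

text \<open>
  In the coordinates \<open>w\<close>, the vector \<open>\<alpha>\<close> is \<open>s e\<^sub>i + t e\<^sub>j\<close>. The indices may coincide, so that
  \<open>2 s e\<^sub>i\<close> is the case \<open>j = i\<close>, \<open>t = s\<close>, and \<open>s e\<^sub>i\<close> is a case with \<open>t = 0\<close>.
\<close>
definition root_coords ::
    "nat \<Rightarrow> (nat \<Rightarrow> 'a::euclidean_space) \<Rightarrow> 'a \<Rightarrow> int \<Rightarrow> nat \<Rightarrow> int \<Rightarrow> nat \<Rightarrow> bool" where
  "root_coords m w \<alpha> s i t j \<longleftrightarrow>
     (\<forall>k<m. \<alpha> \<bullet> w k = of_int (s * of_bool (k = i) + t * of_bool (k = j)))"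

text \<open>
  Coordinates for a root system of classical type: the coordinate \<open>k\<close> of \<open>v\<close> is \<open>v \<bullet> w k\<close>, the \<open>w k\<close>
  span the span of the roots, and every root has at most two nonzero coordinates as in
  \<open>root_coords\<close>. The final disjunction keeps what is needed of the types: coordinate sums of roots vanish
  (type A); all \<open>s e\<^sub>i\<close> are roots (type B); or coordinate sums of roots are even and all
  \<open>s e\<^sub>i + t e\<^sub>k\<close> with \<open>i \<noteq> k\<close> are roots (types C and D).
\<close>
definition classical_coords :: "'a::euclidean_space set \<Rightarrow> nat \<Rightarrow> (nat \<Rightarrow> 'a) \<Rightarrow> bool" where
  "classical_coords \<Psi> m w \<longleftrightarrow>
     (\<forall>k<m. w k \<in> span \<Psi>) \<and> span \<Psi> \<subseteq> span (w ` {..<m}) \<and>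
     (\<forall>\<alpha>\<in>\<Psi>. \<exists>i<m. \<exists>j<m. \<exists>s\<in>{-1, 0, 1}. \<exists>t\<in>{-1, 0, 1}. root_coords m w \<alpha> s i t j) \<and>
     ((\<forall>\<alpha>\<in>\<Psi>. (\<Sum>k<m. \<alpha> \<bullet> w k) = 0) \<or>
      (\<forall>i<m. \<forall>s\<in>{-1, 1}. \<exists>\<beta>\<in>\<Psi>. root_coords m w \<beta> s i 0 i) \<or>
      ((\<forall>\<alpha>\<in>\<Psi>. (\<Sum>k<m. \<alpha> \<bullet> w k) / 2 \<in> \<int>) \<and>
       (\<forall>i<m. \<forall>k<m. i \<noteq> k \<longrightarrow>
          (\<forall>s\<in>{-1, 1}. \<forall>t\<in>{-1, 1}. \<exists>\<beta>\<in>\<Psi>. root_coords m w \<beta> s i t k))))"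

lemma signed_sum_root:
  assumes "root_coords m w \<alpha> s i t j" "i < m" "j < m"
  shows "signed_sum m w x \<bullet> \<alpha> = of_int (s * x i + t * x j)"
proof -
  have "signed_sum m w x \<bullet> \<alpha> = (\<Sum>k<m. of_int (x k) * (\<alpha> \<bullet> w k))"
    by (simp add: signed_sum_def inner_sum_left inner_commute[of \<alpha>])
  also have "\<dots> = (\<Sum>k<m. (if k = i then of_int (s * x i) else 0) + (if k = j then of_int (t * x j) else 0))"
    by (rule sum.cong) (use assms in \<open>auto simp: root_coords_def algebra_simps\<close>)
  also have "\<dots> = of_int (s * x i + t * x j)"
    using assms by (simp add: sum.distrib)
  finally show ?thesis .
qed

lemma span_image_lessThan:
  assumes "v \<in> span (w ` {..<m::nat})"
  shows "\<exists>c. v = (\<Sum>k<m. c k *\<^sub>R w k)"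
proof -
  let ?S = "{v. \<exists>c. v = (\<Sum>k<m. c k *\<^sub>R w k)}"
  have "span (w ` {..<m}) \<subseteq> ?S"
  proof (rule span_minimal)
    show "w ` {..<m} \<subseteq> ?S"
    proof safe
      fix l assume "l < m"
      then show "\<exists>c. w l = (\<Sum>k<m. c k *\<^sub>R w k)"
        by (intro exI[of _ "\<lambda>k. of_bool (k = l)"]) (simp add: of_bool_def if_distrib[of "\<lambda>r. r *\<^sub>R _"] cong: if_cong)
    qed
    show "subspace ?S"
    proof (rule subspaceI)
      show "0 \<in> ?S" by (auto intro!: exI[of _ "\<lambda>k. 0"])
    next
      fix x y assume "x \<in> ?S" "y \<in> ?S"
      then obtain c d where "x = (\<Sum>k<m. c k *\<^sub>R w k)" "y = (\<Sum>k<m. d k *\<^sub>R w k)" by blast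
      then show "x + y \<in> ?S"
        by (auto intro!: exI[of _ "\<lambda>k. c k + d k"] simp: algebra_simps sum.distrib)
    next
      fix a x assume "x \<in> ?S"
      then obtain c where "x = (\<Sum>k<m. c k *\<^sub>R w k)" by blast
      then show "a *\<^sub>R x \<in> ?S"
        by (auto intro!: exI[of _ "\<lambda>k. a * c k"] simp: scaleR_sum_right)
    qed
  qed
  with assms show ?thesis by blast
qed

section \<open>Integral M-convex polyhedra at a lattice point\<close>

lemma root_lattice_Ints:
  assumes "\<And>\<alpha>. \<alpha> \<in> \<Phi> \<Longrightarrow> c \<bullet> \<alpha> \<in> \<int>" "r \<in> root_lattice \<Phi>"
  shows "c \<bullet> r \<in> \<int>"
  using assms unfolding root_lattice_def by (auto simp: inner_sum_right intro!: Ints_sum Ints_mult)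

lemma root_in_lattice:
  assumes "finite \<Phi>" "\<alpha> \<in> \<Phi>" "r \<in> root_lattice \<Phi>"
  shows "r + \<alpha> \<in> root_lattice \<Phi>"
proof -
  obtain c :: "'a \<Rightarrow> int" where c: "r = (\<Sum>\<alpha>\<in>\<Phi>. of_int (c \<alpha>) *\<^sub>R \<alpha>)"
    using assms(3) unfolding root_lattice_def by blast
  have "r + \<alpha> = (\<Sum>\<beta>\<in>\<Phi>. of_int (c \<beta> + of_bool (\<beta> = \<alpha>)) *\<^sub>R \<beta>)"
    using assms(1,2) by (simp add: c scaleR_add_left sum.distrib of_bool_def
        if_distrib[of real_of_int] if_distrib[of "\<lambda>r. r *\<^sub>R _"] cong: if_cong)
  then show ?thesis unfolding root_lattice_def by (auto intro!: exI[of _ "\<lambda>\<beta>. c \<beta> + of_bool (\<beta> = \<alpha>)"])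
qed

text \<open>
  An integral M-convex polyhedron with a distinguished lattice point.
\<close>
locale based_M_polyhedron =
  fixes \<Phi> P :: "'a::euclidean_space set" and p :: 'a
  assumes M_convex: "M_convex_polyhedron \<Phi> P"
    and integral: "integral_set \<Phi> P"
    and base: "p \<in> P" and base_lattice: "p \<in> root_lattice \<Phi>"
begin

lemma closed_P: "closed P" and convex_P: "convex P"
  using M_convex by (auto simp: M_convex_polyhedron_def)

lemma tangent_generators:
  assumes "q \<in> P"
  obtains \<Phi>' where "\<Phi>' \<subseteq> \<Phi>" "tangent_cone q P = convex_cone hull \<Phi>'"
  using M_convex assms unfolding M_convex_polyhedron_def M_convex_cone_def by blast

text \<open>
  The slack \<open>max\<^sub>P c - c p\<close> of the functional \<open>c\<close> at the base point is at most \<open>s\<close>. Stating bounds only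
  avoids the question whether the maximum exists.
\<close>
definition slack_le :: "'a \<Rightarrow> real \<Rightarrow> bool" where
  "slack_le c s \<longleftrightarrow> (\<forall>r\<in>P. c \<bullet> (r - p) \<le> s)"

lemma slack_le_mono: "slack_le c s \<Longrightarrow> s \<le> t \<Longrightarrow> slack_le c t"
  unfolding slack_le_def by (meson order.trans)

lemma slack_le_nonneg: "slack_le c s \<Longrightarrow> s \<ge> 0"
  using base unfolding slack_le_def by fastforce

lemma slack_leI_lattice:
  assumes "\<And>r. r \<in> P \<Longrightarrow> r \<in> root_lattice \<Phi> \<Longrightarrow> c \<bullet> (r - p) \<le> s"
  shows "slack_le c s"
proof -
  have "convex hull (P \<inter> root_lattice \<Phi>) \<subseteq> {r. c \<bullet> r \<le> s + c \<bullet> p}"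
    by (rule hull_minimal) (use assms in \<open>auto simp: convex_halfspace_le inner_diff_right algebra_simps\<close>)
  then show ?thesis using integral unfolding slack_le_def integral_set_def
    by (auto simp: inner_diff_right algebra_simps)
qed

lemma lattice_diff_Ints:
  assumes "\<And>\<alpha>. \<alpha> \<in> \<Phi> \<Longrightarrow> c \<bullet> \<alpha> \<in> \<int>" "r \<in> root_lattice \<Phi>"
  shows "c \<bullet> (r - p) \<in> \<int>"
  using root_lattice_Ints[OF assms(1)] assms(2) base_lattice by (simp add: inner_diff_right)

text \<open>
  A functional that is integral on the roots takes integral values at the lattice points that span \<open>P\<close>.
\<close>
lemma slack_le_round:
  assumes c: "\<And>\<alpha>. \<alpha> \<in> \<Phi> \<Longrightarrow> c \<bullet> \<alpha> \<in> \<int>" and "slack_le c s" "s < of_int n"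
  shows "slack_le c (of_int (n - 1))"
proof (rule slack_leI_lattice)
  fix r assume r: "r \<in> P" "r \<in> root_lattice \<Phi>"
  obtain k where k: "c \<bullet> (r - p) = of_int k" using lattice_diff_Ints[OF c r(2)] by (auto elim: Ints_cases)
  have "c \<bullet> (r - p) < of_int n" using assms(2,3) r(1) unfolding slack_le_def by fastforce
  then have "k \<le> n - 1" unfolding k by simp
  then show "c \<bullet> (r - p) \<le> of_int (n - 1)" unfolding k by (rule of_int_le_iff[THEN iffD2])
qed

lemma slack_attained:
  assumes c: "\<And>\<alpha>. \<alpha> \<in> \<Phi> \<Longrightarrow> c \<bullet> \<alpha> \<in> \<int>" and s: "slack_le c s"
  obtains q where "q \<in> P" "q \<in> root_lattice \<Phi>" "\<And>r. r \<in> P \<Longrightarrow> c \<bullet> r \<le> c \<bullet> q"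
proof -
  define N where "N = {n. \<exists>r\<in>P \<inter> root_lattice \<Phi>. c \<bullet> (r - p) = of_nat n}"
  have bd: "n \<le> nat \<lfloor>s\<rfloor>" if "n \<in> N" for n
  proof -
    have "of_nat n \<le> s" using that s unfolding N_def slack_le_def by force
    then show ?thesis by linarith
  qed
  have fin: "finite N" using bd finite_nat_set_iff_bounded_le by blast
  have "0 \<in> N" unfolding N_def using base base_lattice by (auto intro!: bexI[of _ p])
  then have "Max N \<in> N" using fin by (intro Max_in) auto
  then obtain q where q: "q \<in> P" "q \<in> root_lattice \<Phi>" "c \<bullet> (q - p) = of_nat (Max N)"
    unfolding N_def by blast
  have "slack_le c (of_nat (Max N))"
  proof (rule slack_leI_lattice)
    fix r assume r: "r \<in> P" "r \<in> root_lattice \<Phi>"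
    obtain k where k: "c \<bullet> (r - p) = of_int k" using lattice_diff_Ints[OF c r(2)] by (auto elim: Ints_cases)
    show "c \<bullet> (r - p) \<le> of_nat (Max N)"
    proof (cases "k \<ge> 0")
      case True
      then have "nat k \<in> N" unfolding N_def using r k by auto
      then have "nat k \<le> Max N" using fin by simp
      then show ?thesis unfolding k using True by linarith
    qed (use k in auto)
  qed
  then have "c \<bullet> r \<le> c \<bullet> q" if "r \<in> P" for r
    using that q(3) unfolding slack_le_def by (force simp: inner_diff_right)
  with q show ?thesis using that by blast
qed

text \<open>
  Maximality of a functional over \<open>P\<close> at \<open>q\<close> can be read off the generators of the tangent cone.
\<close>
lemma maximal_iff:
  assumes q: "q \<in> P" and T: "tangent_cone q P = convex_cone hull \<Phi>'"
  shows "(\<forall>r\<in>P. c \<bullet> r \<le> c \<bullet> q) \<longleftrightarrow> (\<forall>\<beta>\<in>\<Phi>'. c \<bullet> \<beta> \<le> 0)"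
proof
  assume max: "\<forall>r\<in>P. c \<bullet> r \<le> c \<bullet> q"
  have "convex_cone hull {r - q | r. r \<in> P} \<subseteq> {v. c \<bullet> v \<le> 0}"
    by (rule hull_minimal) (use max in \<open>auto simp: inner_diff_right convex_cone_halfspace_le\<close>)
  then have "tangent_cone q P \<subseteq> {v. c \<bullet> v \<le> 0}"
    unfolding tangent_cone_def by (rule closure_minimal) (rule closed_halfspace_le)
  moreover have "\<Phi>' \<subseteq> tangent_cone q P" unfolding T by (rule hull_subset)
  ultimately show "\<forall>\<beta>\<in>\<Phi>'. c \<bullet> \<beta> \<le> 0" by blast
next
  assume "\<forall>\<beta>\<in>\<Phi>'. c \<bullet> \<beta> \<le> 0"
  then have "convex_cone hull \<Phi>' \<subseteq> {v. c \<bullet> v \<le> 0}"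
    by (intro hull_minimal) (auto simp: convex_cone_halfspace_le)
  moreover have "r - q \<in> tangent_cone q P" if "r \<in> P" for r
    unfolding tangent_cone_def using that by (intro closure_subset[THEN subsetD] hull_inc) auto
  ultimately have "c \<bullet> (r - q) \<le> 0" if "r \<in> P" for r unfolding T using that by blast
  then show "\<forall>r\<in>P. c \<bullet> r \<le> c \<bullet> q" by (simp add: inner_diff_right)
qed

end

section \<open>One classical component\<close>

text \<open>
  In addition, a subset \<open>\<Psi>\<close> orthogonal to the remaining roots, with classical coordinates.
\<close>
locale based_M_polyhedron_component = based_M_polyhedron +
  fixes \<Psi> :: "'a set" and m :: nat and w :: "nat \<Rightarrow> 'a"
  assumes sub: "\<Psi> \<subseteq> \<Phi>"
    and orth: "\<And>\<alpha> \<beta>. \<alpha> \<in> \<Psi> \<Longrightarrow> \<beta> \<in> \<Phi> - \<Psi> \<Longrightarrow> \<alpha> \<bullet> \<beta> = 0"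
    and coords: "classical_coords \<Psi> m w"
begin

abbreviation X :: "(nat \<Rightarrow> int) \<Rightarrow> 'a" where "X \<equiv> signed_sum m w"

lemma coords_span: "k < m \<Longrightarrow> w k \<in> span \<Psi>" "span \<Psi> \<subseteq> span (w ` {..<m})"
  using coords unfolding classical_coords_def by simp_all

lemma coords_roots:
  "\<forall>\<alpha>\<in>\<Psi>. \<exists>i<m. \<exists>j<m. \<exists>s\<in>{-1, 0, 1}. \<exists>t\<in>{-1, 0, 1}. root_coords m w \<alpha> s i t j"
  using coords unfolding classical_coords_def by (elim conjE)

lemma coords_types:
  "(\<forall>\<alpha>\<in>\<Psi>. (\<Sum>k<m. \<alpha> \<bullet> w k) = 0) \<or>
   (\<forall>i<m. \<forall>s\<in>{-1, 1}. \<exists>\<beta>\<in>\<Psi>. root_coords m w \<beta> s i 0 i) \<or>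
   ((\<forall>\<alpha>\<in>\<Psi>. (\<Sum>k<m. \<alpha> \<bullet> w k) / 2 \<in> \<int>) \<and>
    (\<forall>i<m. \<forall>k<m. i \<noteq> k \<longrightarrow>
       (\<forall>s\<in>{-1, 1}. \<forall>t\<in>{-1, 1}. \<exists>\<beta>\<in>\<Psi>. root_coords m w \<beta> s i t k)))"
  using coords unfolding classical_coords_def by (elim conjE)

lemma root_form:
  assumes "\<alpha> \<in> \<Psi>"
  obtains i j s t where "i < m" "j < m" "s \<in> {-1, 0, 1}" "t \<in> {-1, 0, 1}"
    "root_coords m w \<alpha> s i t j"
  using bspec[OF coords_roots assms] by (elim exE conjE bexE)

lemma span_orth:
  assumes "v \<in> span \<Psi>" "\<beta> \<in> \<Phi> - \<Psi>"
  shows "v \<bullet> \<beta> = 0"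
proof -
  have "\<Psi> \<subseteq> {v. \<beta> \<bullet> v = 0}" using orth assms(2) by (auto simp: inner_commute[of \<beta>])
  then have "span \<Psi> \<subseteq> {v. \<beta> \<bullet> v = 0}" by (intro span_minimal subspace_hyperplane)
  with assms(1) show ?thesis by (auto simp: inner_commute[of \<beta>])
qed

lemma X_span: "X x \<in> span \<Psi>"
  unfolding signed_sum_def by (intro span_sum span_mul coords_span(1)) simp

lemma X_orth: "\<beta> \<in> \<Phi> - \<Psi> \<Longrightarrow> X x \<bullet> \<beta> = 0"
  using span_orth X_span by blast

lemma X_Ints:
  assumes "\<alpha> \<in> \<Phi>"
  shows "X x \<bullet> \<alpha> \<in> \<int>"
proof (cases "\<alpha> \<in> \<Psi>")
  case True
  obtain i j s t where "i < m" "j < m" "s \<in> {-1, 0, 1}" "t \<in> {-1, 0, 1}" "root_coords m w \<alpha> s i t j"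
    by (rule root_form[OF True])
  from signed_sum_root[OF this(5,1,2)] show ?thesis by simp
next
  case False
  then show ?thesis using X_orth[of \<alpha> x] assms by simp
qed

lemma coords_determine:
  assumes "v \<in> span \<Psi>" "u \<in> span \<Psi>" "\<And>k. k < m \<Longrightarrow> v \<bullet> w k = u \<bullet> w k"
  shows "v = u"
proof -
  define d where "d = v - u"
  have "d \<in> span \<Psi>" unfolding d_def using assms by (simp add: span_diff)
  then have "d \<in> span (w ` {..<m})" using coords_span(2) by blast
  moreover have "span (w ` {..<m}) \<subseteq> {z. d \<bullet> z = 0}"
    by (intro span_minimal subspace_hyperplane) (use assms in \<open>auto simp: d_def inner_diff_left\<close>)
  ultimately have "d \<bullet> d = 0" by blast
  then show ?thesis by (simp add: d_def)
qed

text \<open>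
  If \<open>\<beta>\<close> leads out of \<open>P\<close>, then a sign vector supported on the component of \<open>\<beta>\<close> detects this, with
  an integral gap.
\<close>
lemma missing_neighbour_blocked:
  assumes \<beta>: "\<beta> \<in> \<Psi>" and out: "p + \<beta> \<notin> P"
  shows "\<exists>x. sign_vector x \<and> X x \<bullet> \<beta> \<ge> 1 \<and> slack_le (X x) (X x \<bullet> \<beta> - 1)"
proof -
  define q where "q = closest_point P (p + \<beta>)"
  have q: "q \<in> P" unfolding q_def using base by (intro closest_point_in_set closed_P) auto
  define c where "c = p + \<beta> - q"
  have max: "\<forall>r\<in>P. c \<bullet> r \<le> c \<bullet> q"
  proof
    fix r assume "r \<in> P"
    from closest_point_dot[OF convex_P closed_P this, of "p + \<beta>"]
    show "c \<bullet> r \<le> c \<bullet> q" by (simp add: c_def q_def inner_diff_right)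
  qed
  have cne: "c \<noteq> 0" using q out by (auto simp: c_def)
  obtain \<Phi>' where \<Phi>': "\<Phi>' \<subseteq> \<Phi>" "tangent_cone q P = convex_cone hull \<Phi>'"
    using tangent_generators[OF q] .
  note mx = maximal_iff[OF q \<Phi>'(2)]
  have neg: "\<forall>\<gamma>\<in>\<Phi>'. c \<bullet> \<gamma> \<le> 0" using max mx by blast
  \<comment> \<open>The outward normal \<open>c\<close> at the point \<open>q\<close> of \<open>P\<close> nearest to \<open>p + \<beta>\<close> separates; only its part in
    \<open>span \<Psi>\<close> matters, since the other part is orthogonal to \<open>\<beta>\<close> and maximal over \<open>P\<close> at \<open>q\<close>.\<close>
  obtain c1 c2 where c1: "c1 \<in> span \<Psi>" and c2: "\<And>v. v \<in> span \<Psi> \<Longrightarrow> orthogonal c2 v"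
    and c12: "c = c1 + c2"
    using orthogonal_subspace_decomp_exists by blast
  have c2\<Psi>: "c2 \<bullet> \<gamma> = 0" if "\<gamma> \<in> \<Psi>" for \<gamma>
    using c2[OF span_base[OF that]] by (simp add: orthogonal_def)
  have c1\<Phi>: "c1 \<bullet> \<gamma> = 0" if "\<gamma> \<in> \<Phi> - \<Psi>" for \<gamma> using span_orth c1 that by blast
  have "\<forall>\<gamma>\<in>\<Phi>'. c2 \<bullet> \<gamma> \<le> 0"
  proof
    fix \<gamma> assume "\<gamma> \<in> \<Phi>'"
    then show "c2 \<bullet> \<gamma> \<le> 0"
      using neg c2\<Psi>[of \<gamma>] c1\<Phi>[of \<gamma>] \<Phi>'(1) by (cases "\<gamma> \<in> \<Psi>") (force simp: c12 inner_add_left)+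
  qed
  then have "c2 \<bullet> p \<le> c2 \<bullet> q" using mx base by blast
  then have "c2 \<bullet> c \<le> 0" using c2\<Psi>[OF \<beta>] by (simp add: c_def inner_simps)
  moreover have "c \<bullet> c > 0" using cne by simp
  ultimately have pos: "c1 \<bullet> c > 0" by (simp add: c12 inner_add_left)
  have "c1 \<in> span (w ` {..<m})" using c1 coords_span(2) by blast
  then obtain a where a: "c1 = (\<Sum>k<m. a k *\<^sub>R w k)" using span_image_lessThan by blast
  have "(\<Sum>k<m. a k * (w k \<bullet> c)) > 0" using pos unfolding a by (simp add: inner_sum_left)
  from level_positive[OF this]
  obtain u where u: "u > 0" "(\<Sum>k<m. of_int (level u (a k)) * (w k \<bullet> c)) > 0" by blast
  define x where "x k = level u (a k)" for k
  have sx: "sign_vector x" by (auto simp: sign_vector_def x_def level_def)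
  have Xc: "X x \<bullet> c > 0" using u(2) unfolding signed_sum_def x_def by (simp add: inner_sum_left)
  have "\<forall>\<gamma>\<in>\<Phi>'. X x \<bullet> \<gamma> \<le> 0"
  proof
    fix \<gamma> assume \<gamma>: "\<gamma> \<in> \<Phi>'"
    show "X x \<bullet> \<gamma> \<le> 0"
    proof (cases "\<gamma> \<in> \<Psi>")
      case True
      obtain i j s t where ij: "i < m" "j < m" and st: "s \<in> {-1, 0, 1}" "t \<in> {-1, 0, 1}"
        and rc: "root_coords m w \<gamma> s i t j"
        by (rule root_form[OF True])
      note Xg = signed_sum_root[OF rc ij]
      have "c1 \<bullet> \<gamma> = (\<Sum>k<m. a k * (\<gamma> \<bullet> w k))"
        unfolding a by (simp add: inner_sum_left inner_commute[of \<gamma>])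
      also have "\<dots> = (\<Sum>k<m. (if k = i then s * a i else 0) + (if k = j then t * a j else 0))"
        by (rule sum.cong) (use rc in \<open>auto simp: root_coords_def algebra_simps\<close>)
      also have "\<dots> = s * a i + t * a j" using ij by (simp add: sum.distrib)
      finally have "s * a i + t * a j \<le> 0"
        using neg \<gamma> c2\<Psi>[OF True] by (auto simp: c12 inner_add_left)
      then have "s * x i + t * x j \<le> 0" using st u(1) by (auto simp: x_def level_def)
      then show ?thesis unfolding Xg by linarith
    next
      case False
      then show ?thesis using X_orth \<gamma> \<Phi>'(1) by auto
    qed
  qed
  then have Xmax: "\<forall>r\<in>P. X x \<bullet> r \<le> X x \<bullet> q" using mx by blast
  then have sl: "slack_le (X x) (X x \<bullet> (q - p))" unfolding slack_le_def by (auto simp: inner_diff_right)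
  have lt: "X x \<bullet> (q - p) < X x \<bullet> \<beta>" using Xc by (simp add: c_def inner_simps)
  have "X x \<bullet> \<beta> \<in> \<int>" using X_Ints \<beta> sub by blast
  then obtain n where n: "X x \<bullet> \<beta> = of_int n" by (elim Ints_cases)
  have "n \<ge> 1" using slack_le_nonneg[OF sl] lt n by auto
  moreover have "slack_le (X x) (of_int (n - 1))"
    by (rule slack_le_round[OF _ sl]) (use X_Ints lt n in auto)
  ultimately show ?thesis using sx n by (intro exI[of _ x]) auto
qed

text \<open>
  Bisubmodularity of the slack. The functional of \<open>x + y\<close> attains its maximum over \<open>P\<close> at a lattice
  point, where by conformality meet and join are maximal simultaneously.
\<close>
lemma bisubmodular:
  fixes a b :: real
  assumes x: "sign_vector x" "slack_le (X x) a" and y: "sign_vector y" "slack_le (X y) b"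
  obtains a' b' :: int where "slack_le (X (meet x y)) a'" "slack_le (X (join x y)) b'" "of_int (a' + b') \<le> a + b"
proof -
  let ?u = "meet x y" and ?v = "join x y"
  have add: "X ?u + X ?v = X x + X y"
    unfolding signed_sum_def sum.distrib[symmetric] scaleR_add_left[symmetric] of_int_add[symmetric]
    by (simp add: meet_def join_def)
  have Z: "(X x + X y) \<bullet> \<alpha> \<in> \<int>" if "\<alpha> \<in> \<Phi>" for \<alpha>
    using X_Ints that by (simp add: inner_add_left)
  have "slack_le (X x + X y) (a + b)"
    using x y unfolding slack_le_def by (auto simp: inner_add_left intro: add_mono)
  from slack_attained[OF Z this] obtain q where q: "q \<in> P" "q \<in> root_lattice \<Phi>"
    and max: "\<And>r. r \<in> P \<Longrightarrow> (X x + X y) \<bullet> r \<le> (X x + X y) \<bullet> q" by metis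
  obtain \<Phi>' where \<Phi>': "\<Phi>' \<subseteq> \<Phi>" "tangent_cone q P = convex_cone hull \<Phi>'"
    using tangent_generators[OF q(1)] .
  note mx = maximal_iff[OF q(1) \<Phi>'(2)]
  have neg: "\<forall>\<gamma>\<in>\<Phi>'. (X ?u + X ?v) \<bullet> \<gamma> \<le> 0" using max mx add by auto
  have "X ?u \<bullet> \<gamma> \<le> 0 \<and> X ?v \<bullet> \<gamma> \<le> 0" if "\<gamma> \<in> \<Phi>'" for \<gamma>
  proof (cases "\<gamma> \<in> \<Psi>")
    case True
    obtain i j s t where ij: "i < m" "j < m" and st: "s \<in> {-1, 0, 1}" "t \<in> {-1, 0, 1}"
        and rc: "root_coords m w \<gamma> s i t j"
        by (rule root_form[OF True])
      note Xg = signed_sum_root[OF rc ij]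
    have "s * ?u i + t * ?u j + (s * ?v i + t * ?v j) \<le> 0"
    proof -
      have "(X ?u + X ?v) \<bullet> \<gamma> \<le> 0" using neg that by blast
      then show ?thesis
        unfolding inner_add_left Xg by (simp only: of_int_add[symmetric] of_int_le_0_iff)
    qed
    from join_meet_conformal[OF x(1) y(1) st this] show ?thesis unfolding Xg by linarith
  next
    case False
    then show ?thesis using X_orth that \<Phi>'(1) by auto
  qed
  then have "\<forall>r\<in>P. X ?u \<bullet> r \<le> X ?u \<bullet> q" "\<forall>r\<in>P. X ?v \<bullet> r \<le> X ?v \<bullet> q" using mx by blast+
  then have sl: "slack_le (X ?u) (X ?u \<bullet> (q - p))" "slack_le (X ?v) (X ?v \<bullet> (q - p))"
    unfolding slack_le_def by (auto simp: inner_diff_right)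
  obtain a' b' :: int where ab: "X ?u \<bullet> (q - p) = a'" "X ?v \<bullet> (q - p) = b'"
    using lattice_diff_Ints[OF X_Ints q(2)] by (metis Ints_cases)
  have "of_int (a' + b') = (X x + X y) \<bullet> (q - p)" unfolding add[symmetric] inner_add_left ab by simp
  also have "\<dots> \<le> a + b" using x(2) y(2) q(1) unfolding slack_le_def by (auto simp: inner_add_left intro: add_mono)
  finally show ?thesis using that sl ab by auto
qed

lemma join_slack:
  fixes b :: real
  assumes x: "sign_vector x" "slack_le (X x) 1" and y: "sign_vector y" "slack_le (X y) b" "b \<le> 1"
    and "b = 0 \<or> \<not> slack_le (X (meet x y)) 0"
  shows "slack_le (X (join x y)) 1"
proof -
  obtain a' b' :: int where ab: "slack_le (X (meet x y)) a'" "slack_le (X (join x y)) b'" "of_int (a' + b') \<le> 1 + b"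
    using bisubmodular[OF x y(1,2)] .
  have "a' \<ge> 0" using slack_le_nonneg[OF ab(1)] by simp
  moreover have "a' \<noteq> 0" if "b \<noteq> 0" using ab(1) assms(6) that by auto
  ultimately have "of_int a' \<ge> b" using y(3) by (cases "b = 0") auto
  then have "of_int b' \<le> (1::real)" using ab(3) by linarith
  then show ?thesis using ab(2) slack_le_mono by auto
qed

lemma tight_meet_or_join:
  assumes x: "sign_vector x" "slack_le (X x) 1" and y: "sign_vector y" "slack_le (X y) 0"
  shows "slack_le (X (meet x y)) 0 \<or> slack_le (X (join x y)) 0"
proof -
  obtain a' b' :: int where ab: "slack_le (X (meet x y)) a'" "slack_le (X (join x y)) b'" "of_int (a' + b') \<le> 1 + (0::real)"
    using bisubmodular[OF x y] .
  have "a' \<ge> 0" "b' \<ge> 0" using slack_le_nonneg ab(1,2) by fastforce+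
  then have "a' = 0 \<or> b' = 0" using ab(3) by linarith
  then show ?thesis using ab by auto
qed

text \<open>
  No sign vector of slack \<open>0\<close> has entry \<open>s\<close> at \<open>i\<close>: as far as the sign vectors can tell, \<open>s e\<^sub>i\<close> belongs to the
  tangent cone at \<open>p\<close>, although it need not be a root.
\<close>
definition free :: "nat \<Rightarrow> int \<Rightarrow> bool" where
  "free i s \<longleftrightarrow> (\<forall>y. sign_vector y \<longrightarrow> y i = s \<longrightarrow> \<not> slack_le (X y) 0)"

text \<open>
  The heart of the argument, where the types are treated separately: \<open>2 s e\<^sub>i\<close> is a sum
  of two roots that lead from \<open>p\<close> into \<open>P\<close>. The sign vector \<open>x0\<close> of slack at most \<open>1\<close> matters for
  types C and D only: among such sign vectors with entry \<open>s\<close> at \<open>i\<close> one of maximal support is chosen,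
  and the second coordinate \<open>k\<close> of the two roots is taken outside its support.
\<close>
lemma free_direction:
  assumes i: "i < m" and s: "s \<in> {-1, 1}" and free: "free i s"
    and x0: "sign_vector x0" "x0 i = s" "slack_le (X x0) 1"
  shows "\<exists>\<beta>1\<in>\<Psi>. \<exists>\<beta>2\<in>\<Psi>. p + \<beta>1 \<in> P \<and> p + \<beta>2 \<in> P \<and>
           (\<forall>k<m. (\<beta>1 + \<beta>2) \<bullet> w k = of_int (2 * s * of_bool (k = i)))"
proof -
  consider (A) "\<forall>\<alpha>\<in>\<Psi>. (\<Sum>k<m. \<alpha> \<bullet> w k) = 0"
    | (B) "\<forall>i<m. \<forall>s\<in>{-1, 1}. \<exists>\<beta>\<in>\<Psi>. root_coords m w \<beta> s i 0 i"
    | (CD) "\<forall>\<alpha>\<in>\<Psi>. (\<Sum>k<m. \<alpha> \<bullet> w k) / 2 \<in> \<int>"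
       "\<forall>i<m. \<forall>k<m. i \<noteq> k \<longrightarrow> (\<forall>s\<in>{-1, 1}. \<forall>t\<in>{-1, 1}. \<exists>\<beta>\<in>\<Psi>. root_coords m w \<beta> s i t k)"
    using coords_types by (elim disjE conjE)
  then show ?thesis
  proof cases
    case A
    let ?y = "\<lambda>k::nat. s"
    have sy: "sign_vector ?y" using s by (auto simp: sign_vector_def)
    have z: "X ?y \<bullet> \<alpha> = 0" if "\<alpha> \<in> \<Phi>" for \<alpha>
    proof (cases "\<alpha> \<in> \<Psi>")
      case True
      have "X ?y \<bullet> \<alpha> = s * (\<Sum>k<m. \<alpha> \<bullet> w k)"
        by (simp add: signed_sum_def inner_sum_left sum_distrib_left inner_commute[of \<alpha>])
      then show ?thesis using A True by simp
    qed (use X_orth that in auto)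
    obtain \<Phi>' where \<Phi>': "\<Phi>' \<subseteq> \<Phi>" "tangent_cone p P = convex_cone hull \<Phi>'"
      using tangent_generators[OF base] .
    have "\<forall>r\<in>P. X ?y \<bullet> r \<le> X ?y \<bullet> p" unfolding maximal_iff[OF base \<Phi>'(2)] using z \<Phi>'(1) by auto
    then have "slack_le (X ?y) 0" unfolding slack_le_def by (auto simp: inner_diff_right)
    then show ?thesis using free sy unfolding free_def by blast
  next
    case B
    then obtain \<beta> where \<beta>: "\<beta> \<in> \<Psi>" "root_coords m w \<beta> s i 0 i" using i s by blast
    have "p + \<beta> \<in> P"
    proof (rule ccontr)
      assume "p + \<beta> \<notin> P"
      from missing_neighbour_blocked[OF \<beta>(1) this] obtain x where x: "sign_vector x"
        "X x \<bullet> \<beta> \<ge> 1" "slack_le (X x) (X x \<bullet> \<beta> - 1)" by blast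
      have Xb: "X x \<bullet> \<beta> = of_int (s * x i)" using signed_sum_root[OF \<beta>(2) i i] by simp
      have "s * x i \<ge> 1" using x(2) unfolding Xb by (simp only: of_int_1_le_iff)
      then have xi: "x i = s" "s * x i = 1"
        using s sign_vectorD[OF x(1), of i] by auto
      have "X x \<bullet> \<beta> = 1" unfolding Xb xi(2) by simp
      then show False using free x xi(1) unfolding free_def by simp
    qed
    then show ?thesis using \<beta> by (intro bexI[of _ \<beta>]) (auto simp: root_coords_def inner_add_left)
  next
    case CD
    define C where "C = {x. sign_vector x \<and> x i = s \<and> slack_le (X x) 1}"
    define supp where "supp x = {k. k < m \<and> x k \<noteq> 0}" for x :: "nat \<Rightarrow> int"
    have "\<exists>x. x \<in> C \<and> (\<forall>y. y \<in> C \<longrightarrow> card (supp y) \<le> card (supp x))"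
    proof (rule ex_has_greatest_nat[of "\<lambda>x. x \<in> C" x0 "\<lambda>x. card (supp x)" "Suc m"])
      show "x0 \<in> C" using x0 by (auto simp: C_def)
      show "\<forall>y. y \<in> C \<longrightarrow> card (supp y) < Suc m"
      proof (intro allI impI)
        fix y
        have "card (supp y) \<le> card {..<m}" by (rule card_mono) (auto simp: supp_def)
        then show "card (supp y) < Suc m" by simp
      qed
    qed
    then obtain x where xC: "x \<in> C" and xmax: "\<And>y. y \<in> C \<Longrightarrow> card (supp y) \<le> card (supp x)" by blast
    have x: "sign_vector x" "x i = s" "slack_le (X x) 1" using xC by (auto simp: C_def)
    have joinC: "join y z \<in> C" if "y \<in> C" "z \<in> C" for y z
    proof -
      have sv: "sign_vector (meet y z)" using that by (auto simp: C_def sign_vector_meet)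
      have "meet y z i = s" "join y z i = s" using that s by (auto simp: C_def meet_def join_def)
      moreover from this have "\<not> slack_le (X (meet y z)) 0" using free sv unfolding free_def by blast
      ultimately show ?thesis using that join_slack[of y z 1] by (auto simp: C_def sign_vector_join)
    qed
    \<comment> \<open>Joining \<open>x\<close> with \<open>y\<close> may lose conflicting coordinates; joining with \<open>x\<close> once more restores them,
      and keeps \<open>k\<close>, where \<open>x\<close> vanishes.\<close>
    have no_ext: "y k = 0" if "y \<in> C" "k < m" "x k = 0" for y k
    proof (rule ccontr)
      assume yk: "y k \<noteq> 0"
      let ?z = "join (join x y) x"
      have "?z \<in> C" using joinC xC that(1) by blast
      have "supp x \<union> {k} \<subseteq> supp ?z"
      proof
        fix l assume "l \<in> supp x \<union> {k}"
        then show "l \<in> supp ?z"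
          using that yk sign_vectorD[OF x(1), of l] sign_vectorD[of y l]
          by (auto simp: supp_def join_def C_def)
      qed
      then have "card (supp x \<union> {k}) \<le> card (supp ?z)" by (intro card_mono) (auto simp: supp_def)
      moreover have "card (supp x \<union> {k}) = Suc (card (supp x))"
        using that by (simp add: supp_def)
      ultimately show False using xmax[OF \<open>?z \<in> C\<close>] by simp
    qed
    \<comment> \<open>With full support \<open>x\<close> would be even on the lattice, so that slack at most \<open>1\<close> would be slack \<open>0\<close>.\<close>
    have "\<exists>k<m. x k = 0"
    proof (rule ccontr)
      assume "\<not> (\<exists>k<m. x k = 0)"
      then have full: "x k \<noteq> 0" if "k < m" for k using that by blast
      have Z: "((1/2) *\<^sub>R X x) \<bullet> \<alpha> \<in> \<int>" if "\<alpha> \<in> \<Phi>" for \<alpha>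
      proof (cases "\<alpha> \<in> \<Psi>")
        case True
        obtain i j s t where ij: "i < m" "j < m" and st: "s \<in> {-1, 0, 1}" "t \<in> {-1, 0, 1}"
        and rc: "root_coords m w \<alpha> s i t j"
        by (rule root_form[OF True])
      note Xg = signed_sum_root[OF rc ij]
        have "(\<Sum>k<m. \<alpha> \<bullet> w k) = X (\<lambda>k. 1) \<bullet> \<alpha>"
          by (simp add: signed_sum_def inner_sum_left inner_commute[of \<alpha>])
        then have "real_of_int (s + t) / 2 \<in> \<int>" using CD(1) True Xg by auto
        then obtain n where "real_of_int (s + t) / 2 = of_int n" by (auto elim: Ints_cases)
        then have "real_of_int (s + t) = of_int (2 * n)" by simp
        then have n: "s + t = 2 * n" by (simp only: of_int_eq_iff)
        have "even (s * x i + t * x j)"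
        proof -
          have "odd (x i)" "odd (x j)"
            using full[OF ij(1)] full[OF ij(2)] sign_vectorD[OF x(1), of i] sign_vectorD[OF x(1), of j] by auto
          moreover have "even (s + t)" using n by simp
          ultimately show ?thesis by auto
        qed
        then obtain l where l: "s * x i + t * x j = 2 * l" by (rule evenE)
        have "((1/2) *\<^sub>R X x) \<bullet> \<alpha> = of_int l" unfolding inner_scaleR_left Xg l by simp
        then show ?thesis by simp
      qed (use X_orth that in auto)
      have "slack_le ((1/2) *\<^sub>R X x) (1/2)" using x(3) unfolding slack_le_def by auto
      from slack_le_round[OF Z this, of 1] have "slack_le (X x) 0" unfolding slack_le_def by auto
      then show False using free x unfolding free_def by blast
    qed
    then obtain k where k: "k < m" "x k = 0" by blast
    have ik: "i \<noteq> k" using k x s by auto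
    have good: "p + \<beta> \<in> P" if \<beta>: "\<beta> \<in> \<Psi>" "root_coords m w \<beta> s i t k" and t: "t \<in> {-1, 1}" for \<beta> t
    proof (rule ccontr)
      assume "p + \<beta> \<notin> P"
      \<comment> \<open>Either \<open>y\<close> itself or its join with \<open>x\<close> lies in \<open>C\<close> and does not vanish at \<open>k\<close>, against the
        maximality of \<open>x\<close>, or \<open>y\<close> has slack \<open>0\<close> and entry \<open>s\<close> at \<open>i\<close>, against \<open>free i s\<close>.\<close>
      from missing_neighbour_blocked[OF \<beta>(1) this] obtain y where y: "sign_vector y"
        "X y \<bullet> \<beta> \<ge> 1" "slack_le (X y) (X y \<bullet> \<beta> - 1)" by blast
      have Xy: "X y \<bullet> \<beta> = of_int (s * y i + t * y k)" using signed_sum_root[OF \<beta>(2) i k(1)] by simp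
      have ge: "s * y i + t * y k \<ge> 1" using y(2) unfolding Xy by (simp only: of_int_1_le_iff)
      show False
      proof (cases "y i = s")
        case True
        have sy: "s * y i = 1" using True s by auto
        then have "s * y i + t * y k \<le> 2" using t sign_vectorD[OF y(1), of k] by auto
        then have "X y \<bullet> \<beta> - 1 \<le> 1" unfolding Xy by linarith
        then have yC: "y \<in> C" using y(1) True slack_le_mono[OF y(3)] by (auto simp: C_def)
        then have "y k = 0" using no_ext k by blast
        then have "s * y i + t * y k = 1" using sy by simp
        then have "X y \<bullet> \<beta> - 1 = 0" unfolding Xy by (simp only: of_int_1 diff_self)
        then show False using y(1,3) True free unfolding free_def by simp
      next
        case False
        have yi: "y i = 0" "y k = t" "s * y i + t * y k = 1"
          using False ge s t sign_vectorD[OF y(1), of i] sign_vectorD[OF y(1), of k] by auto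
        have "X y \<bullet> \<beta> - 1 = 0" unfolding Xy yi(3) by simp
        then have y0: "slack_le (X y) 0" using y(3) by simp
        have "slack_le (X (join x y)) 1" using join_slack[OF x(1,3) y(1) y0] by simp
        then have "join x y \<in> C" using yi x s by (auto simp: C_def sign_vector_join join_def)
        then have "join x y k = 0" using no_ext k by blast
        then show False using k yi t by (auto simp: join_def)
      qed
    qed
    obtain \<beta>1 \<beta>2 where "\<beta>1 \<in> \<Psi>" "root_coords m w \<beta>1 s i 1 k" "\<beta>2 \<in> \<Psi>" "root_coords m w \<beta>2 s i (-1) k"
      using CD(2) i k(1) ik s by (metis insertI1 insertI2)
    then show ?thesis
      using good[of \<beta>1 1] good[of \<beta>2 "-1"]
      by (intro bexI[of _ \<beta>1] bexI[of _ \<beta>2]) (auto simp: root_coords_def inner_add_left)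
  qed
qed

text \<open>
  The dual form of the claim that every root of \<open>\<Psi>\<close> among the generators of the tangent cone at \<open>p\<close> is
  a nonnegative combination of roots that lead from \<open>p\<close> into \<open>P\<close>.
\<close>
lemma tangent_root_of_component:
  assumes c: "\<And>\<beta>. \<beta> \<in> \<Phi> \<Longrightarrow> p + \<beta> \<in> P \<Longrightarrow> c \<bullet> \<beta> \<le> 0"
    and T: "\<Phi>' \<subseteq> \<Phi>" "tangent_cone p P = convex_cone hull \<Phi>'"
    and \<alpha>: "\<alpha> \<in> \<Phi>'" "\<alpha> \<in> \<Psi>"
  shows "c \<bullet> \<alpha> \<le> 0"
proof (cases "p + \<alpha> \<in> P")
  case True
  then show ?thesis using c \<alpha> sub by blast
next
  case False
  have tight: "X y \<bullet> \<alpha> \<le> 0" if "slack_le (X y) 0" for y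
    using that maximal_iff[OF base T(2), of "X y"] \<alpha>(1) unfolding slack_le_def by (auto simp: inner_diff_right)
  obtain i j s t where ij: "i < m" "j < m" and st: "s \<in> {-1, 0, 1}" "t \<in> {-1, 0, 1}"
        and rc: "root_coords m w \<alpha> s i t j"
        by (rule root_form[OF \<alpha>(2)])
      note Xa = signed_sum_root[OF rc ij]
  obtain x where x: "sign_vector x" "X x \<bullet> \<alpha> \<ge> 1" "slack_le (X x) (X x \<bullet> \<alpha> - 1)"
    using missing_neighbour_blocked[OF \<alpha>(2) False] by blast
  have "s * x i + t * x j \<noteq> 1"
  proof
    assume "s * x i + t * x j = 1"
    then have "X x \<bullet> \<alpha> = 1" unfolding Xa by (simp only: of_int_1)
    then show False using tight[of x] x by simp
  qed
  moreover have "s * x i + t * x j \<ge> 1" using x(2) unfolding Xa by (simp only: of_int_1_le_iff)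
  ultimately have xs: "s \<in> {-1, 1}" "x i = s" "t \<in> {-1, 1}" "x j = t"
    using st sign_vectorD[OF x(1), of i] sign_vectorD[OF x(1), of j] by auto
  have "s * x i + t * x j = 2" using xs by auto
  then have "X x \<bullet> \<alpha> - 1 = 1" unfolding Xa by simp
  then have x1: "slack_le (X x) 1" using x(3) by simp
  have fr: "\<not> slack_le (X y) 0" if "sign_vector y" "y i = s \<or> y j = t" for y
  proof
    assume y0: "slack_le (X y) 0"
    have "s * y i + t * y j \<le> 0" using tight[OF y0] unfolding Xa by (simp only: of_int_le_0_iff)
    then have "s * meet x y i + t * meet x y j = 1 \<and> s * join x y i + t * join x y j = 1"
      using that xs sign_vectorD[OF that(1), of i] sign_vectorD[OF that(1), of j]
      by (auto simp: meet_def join_def)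
    then have "X (meet x y) \<bullet> \<alpha> = 1" "X (join x y) \<bullet> \<alpha> = 1" unfolding Xa by (simp_all only: of_int_1)
    then show False
      using tight_meet_or_join[OF x(1) x1 that(1) y0] tight[of "meet x y"] tight[of "join x y"] by auto
  qed
  have fr': "free i s" "free j t" using fr unfolding free_def by auto
  obtain \<beta>1 \<beta>2 where b: "\<beta>1 \<in> \<Psi>" "\<beta>2 \<in> \<Psi>" "p + \<beta>1 \<in> P" "p + \<beta>2 \<in> P"
     "\<forall>k<m. (\<beta>1 + \<beta>2) \<bullet> w k = of_int (2 * s * of_bool (k = i))"
    using free_direction[OF ij(1) xs(1) fr'(1) x(1) xs(2) x1] by blast
  obtain \<gamma>1 \<gamma>2 where g: "\<gamma>1 \<in> \<Psi>" "\<gamma>2 \<in> \<Psi>" "p + \<gamma>1 \<in> P" "p + \<gamma>2 \<in> P"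
     "\<forall>k<m. (\<gamma>1 + \<gamma>2) \<bullet> w k = of_int (2 * t * of_bool (k = j))"
    using free_direction[OF ij(2) xs(3) fr'(2) x(1) xs(4) x1] by blast
  have "2 *\<^sub>R \<alpha> = (\<beta>1 + \<beta>2) + (\<gamma>1 + \<gamma>2)"
  proof (rule coords_determine)
    show "2 *\<^sub>R \<alpha> \<in> span \<Psi>" using \<alpha>(2) by (intro span_mul span_base)
    show "(\<beta>1 + \<beta>2) + (\<gamma>1 + \<gamma>2) \<in> span \<Psi>" using b g by (intro span_add span_base)
    fix k assume k: "k < m"
    show "2 *\<^sub>R \<alpha> \<bullet> w k = ((\<beta>1 + \<beta>2) + (\<gamma>1 + \<gamma>2)) \<bullet> w k"
      unfolding inner_add_left[of "\<beta>1 + \<beta>2"] b(5)[rule_format, OF k] g(5)[rule_format, OF k]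
      using rc k by (simp add: root_coords_def)
  qed
  then have "2 * (c \<bullet> \<alpha>) = c \<bullet> \<beta>1 + c \<bullet> \<beta>2 + (c \<bullet> \<gamma>1 + c \<bullet> \<gamma>2)"
    by (metis inner_add_right inner_scaleR_right)
  moreover have "c \<bullet> \<beta>1 \<le> 0" "c \<bullet> \<beta>2 \<le> 0" "c \<bullet> \<gamma>1 \<le> 0" "c \<bullet> \<gamma>2 \<le> 0" using c b g sub by blast+
  ultimately show ?thesis by linarith
qed

end

section \<open>Irreducible components\<close>

text \<open>
  The component of \<open>\<alpha>\<close> is a smallest set of roots that contains \<open>\<alpha>\<close> and is orthogonal to all
  remaining roots.
\<close>
lemma root_in_irreducible_component:
  fixes \<Phi> :: "'a::euclidean_space set"
  assumes \<Phi>: "root_system \<Phi>" and \<alpha>: "\<alpha> \<in> \<Phi>"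
  shows "\<exists>\<Psi>\<in>irreducible_components \<Phi>. \<alpha> \<in> \<Psi>"
proof -
  have fin: "finite \<Phi>" and nz: "0 \<notin> \<Phi>"
    and refl: "\<And>x y. x \<in> \<Phi> \<Longrightarrow> y \<in> \<Phi> \<Longrightarrow> reflection x y \<in> \<Phi>"
    and line: "\<And>x. x \<in> \<Phi> \<Longrightarrow> span {x} \<inter> \<Phi> = {x, - x}"
    and int: "\<And>x y. x \<in> \<Phi> \<Longrightarrow> y \<in> \<Phi> \<Longrightarrow> x \<bullet> coroot y \<in> \<int>"
    using \<Phi> unfolding root_system_def by auto
  define split where "split S \<longleftrightarrow> \<alpha> \<in> S \<and> S \<subseteq> \<Phi> \<and> (\<forall>x\<in>S. \<forall>y\<in>\<Phi> - S. x \<bullet> y = 0)" for S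
  have "split \<Phi>" using \<alpha> by (auto simp: split_def)
  from ex_has_least_nat[of split, OF this, of card]
  obtain \<Psi> where \<Psi>: "split \<Psi>" and least: "\<And>S. split S \<Longrightarrow> card \<Psi> \<le> card S" by blast
  have sub: "\<Psi> \<subseteq> \<Phi>" and \<alpha>\<Psi>: "\<alpha> \<in> \<Psi>" and orth: "\<And>x y. x \<in> \<Psi> \<Longrightarrow> y \<in> \<Phi> - \<Psi> \<Longrightarrow> x \<bullet> y = 0"
    using \<Psi> by (auto simp: split_def)
  have refl\<Psi>: "reflection x y \<in> \<Psi>" if "x \<in> \<Psi>" "y \<in> \<Psi>" for x y
  proof (rule ccontr)
    assume "reflection x y \<notin> \<Psi>"
    then have out: "reflection x y \<in> \<Phi> - \<Psi>" using refl that sub by blast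
    have "reflection x y \<bullet> reflection x y
        = y \<bullet> reflection x y - (y \<bullet> coroot x) * (x \<bullet> reflection x y)"
      by (subst (1) reflection_def) (simp add: inner_diff_left)
    then have "reflection x y = 0" using orth[OF that(1) out] orth[OF that(2) out] by simp
    then show False using out nz by simp
  qed
  have neg\<Psi>: "- x \<in> \<Psi>" if "x \<in> \<Psi>" for x
  proof (rule ccontr)
    assume "- x \<notin> \<Psi>"
    moreover have "- x \<in> \<Phi>" using line[of x] that sub by auto
    ultimately have "x \<bullet> - x = 0" using orth that by blast
    then show False using that sub nz by auto
  qed
  have rs: "root_system \<Psi>"
    unfolding root_system_def
  proof (intro conjI ballI)
    show "finite \<Psi>" using fin sub finite_subset by blast
    show "\<Psi> \<noteq> {}" using \<alpha>\<Psi> by blast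
    show "0 \<notin> \<Psi>" using nz sub by blast
    show "reflection x y \<in> \<Psi>" if "x \<in> \<Psi>" "y \<in> \<Psi>" for x y using refl\<Psi> that .
    show "span {x} \<inter> \<Psi> = {x, - x}" if "x \<in> \<Psi>" for x
      using line[of x] that neg\<Psi>[of x] sub by blast
    show "x \<bullet> coroot y \<in> \<int>" if "x \<in> \<Psi>" "y \<in> \<Psi>" for x y using int that sub by blast
  qed
  have no_split: False
    if AB: "A \<union> B = \<Psi>" "\<forall>x\<in>A. \<forall>y\<in>B. x \<bullet> y = 0" "B \<noteq> {}" "\<alpha> \<in> A" for A B
  proof -
    have "split A" using AB sub orth unfolding split_def by blast
    then have "A = \<Psi>"
      using least[of A] AB(1) fin sub by (intro card_seteq) (auto intro: finite_subset)
    then obtain b where "b \<in> B" "b \<in> A" using AB by blast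
    then have "b \<bullet> b = 0" using AB(2) by blast
    then have "b = 0" by simp
    then show False using \<open>b \<in> A\<close> \<open>A = \<Psi>\<close> sub nz by blast
  qed
  have "irreducible_root_system \<Psi>"
    unfolding irreducible_root_system_def
  proof (intro conjI notI rs)
    assume "\<exists>A B. A \<noteq> {} \<and> B \<noteq> {} \<and> A \<union> B = \<Psi> \<and> (\<forall>\<alpha>\<in>A. \<forall>\<beta>\<in>B. \<alpha> \<bullet> \<beta> = 0)"
    then obtain A B where AB: "A \<noteq> {}" "B \<noteq> {}" "A \<union> B = \<Psi>" "\<forall>x\<in>A. \<forall>y\<in>B. x \<bullet> y = 0" by blast
    then have "B \<union> A = \<Psi>" "\<forall>x\<in>B. \<forall>y\<in>A. x \<bullet> y = 0" by (blast, metis inner_commute)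
    then show False using no_split[of A B] no_split[of B A] AB \<alpha>\<Psi> by blast
  qed
  then have "\<Psi> \<in> irreducible_components \<Phi>"
    using sub orth unfolding irreducible_components_def by blast
  with \<alpha>\<Psi> show ?thesis by blast
qed

section \<open>Coordinates on components of classical type\<close>

text \<open>
  The coordinate functionals of the isomorphism, represented by vectors of the span of the roots.
\<close>
lemma isomorphic_model_coords:
  fixes \<Psi> :: "'a::euclidean_space set"
  assumes iso: "isomorphic_to_model \<Psi> m M" and supp: "\<forall>a\<in>M. \<forall>k\<ge>m. a k = 0"
  shows "\<exists>w. (\<forall>k. w k \<in> span \<Psi>) \<and> span \<Psi> \<subseteq> span (w ` {..<m}) \<and>
    (\<forall>\<alpha>\<in>\<Psi>. \<exists>a\<in>M. \<forall>k. \<alpha> \<bullet> w k = a k) \<and> (\<forall>a\<in>M. \<exists>\<alpha>\<in>\<Psi>. \<forall>k. \<alpha> \<bullet> w k = a k)"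
proof -
  obtain f :: "'a \<Rightarrow> nat \<Rightarrow> real" where lin: "\<And>k. linear (\<lambda>p. f p k)"
    and inj: "inj_on f (span \<Psi>)" and img: "f ` \<Psi> = M"
    using iso unfolding isomorphic_to_model_def by blast
  have "\<exists>y. y \<in> span \<Psi> \<and> (\<forall>v\<in>span \<Psi>. v \<bullet> y = f v k)" for k
  proof -
    obtain y z where yz: "y \<in> span \<Psi>" "\<And>v. v \<in> span \<Psi> \<Longrightarrow> orthogonal z v"
      "adjoint (\<lambda>p. f p k) 1 = y + z"
      using orthogonal_subspace_decomp_exists[of \<Psi> "adjoint (\<lambda>p. f p k) 1"] by blast
    have "v \<bullet> y = f v k" if "v \<in> span \<Psi>" for v
    proof -
      have "v \<bullet> (y + z) = f v k" using adjoint_works[OF lin[of k], of v 1] yz(3) by simp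
      then show ?thesis using yz(2)[OF that] by (simp add: inner_add_right orthogonal_def inner_commute)
    qed
    with yz(1) show ?thesis by blast
  qed
  then obtain w where w: "\<And>k. w k \<in> span \<Psi>" "\<And>k v. v \<in> span \<Psi> \<Longrightarrow> v \<bullet> w k = f v k" by metis
  have f0: "f v k = 0" if "v \<in> span \<Psi>" "k \<ge> m" for v k
  proof -
    have "\<Psi> \<subseteq> {v. w k \<bullet> v = 0}"
      using w(2) span_base supp that(2) img by (force simp: inner_commute[of "w k"])
    then have "span \<Psi> \<subseteq> {v. w k \<bullet> v = 0}" by (intro span_minimal subspace_hyperplane)
    then show ?thesis using that w(2)[OF that(1), of k] by (auto simp: inner_commute)
  qed
  have span: "span \<Psi> \<subseteq> span (w ` {..<m})"
  proof
    fix v assume v: "v \<in> span \<Psi>"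
    obtain y z where yz: "y \<in> span (w ` {..<m})" "\<And>u. u \<in> span (w ` {..<m}) \<Longrightarrow> orthogonal z u" "v = y + z"
      using orthogonal_subspace_decomp_exists[of "w ` {..<m}" v] by blast
    have "span (w ` {..<m}) \<subseteq> span \<Psi>" using w(1) by (intro span_minimal) auto
    then have z: "z \<in> span \<Psi>" using yz v by (metis add_diff_cancel_left' span_diff subsetD)
    have "f z k = f 0 k" for k
    proof (cases "k < m")
      case True
      then have "z \<bullet> w k = 0" using yz(2)[of "w k"] by (auto simp: orthogonal_def intro: span_base)
      then show ?thesis using w(2)[OF z, of k] linear_0[OF lin[of k]] by simp
    qed (use f0[OF z] linear_0[OF lin] in auto)
    then have "z = 0" using inj z by (intro inj_onD[OF inj]) (auto intro: span_zero)
    then show "v \<in> span (w ` {..<m})" using yz by simp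
  qed
  show ?thesis
  proof (intro exI[of _ w] conjI ballI allI w(1) span)
    show "\<exists>a\<in>M. \<forall>k. \<alpha> \<bullet> w k = a k" if "\<alpha> \<in> \<Psi>" for \<alpha>
      using w(2)[OF span_base[OF that]] img that by blast
    show "\<exists>\<alpha>\<in>\<Psi>. \<forall>k. \<alpha> \<bullet> w k = a k" if "a \<in> M" for a
    proof -
      obtain \<alpha> where "\<alpha> \<in> \<Psi>" "a = f \<alpha>" using \<open>a \<in> M\<close> img by blast
      then show ?thesis using w(2)[OF span_base] by blast
    qed
  qed
qed

text \<open>
  The analogue of \<open>root_coords\<close> for vectors of the standard models.
\<close>
definition two_term_form :: "(nat \<Rightarrow> real) \<Rightarrow> int \<Rightarrow> nat \<Rightarrow> int \<Rightarrow> nat \<Rightarrow> bool" where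
  "two_term_form a s i t j \<longleftrightarrow> (\<forall>k. a k = of_int (s * of_bool (k = i) + t * of_bool (k = j)))"

lemma classical_coords_of_model:
  fixes \<Psi> :: "'a::euclidean_space set"
  assumes iso: "isomorphic_to_model \<Psi> m M"
    and form: "\<And>a. a \<in> M \<Longrightarrow> \<exists>i<m. \<exists>j<m. \<exists>s\<in>{-1, 0, 1}. \<exists>t\<in>{-1, 0, 1}. two_term_form a s i t j"
    and types: "(\<forall>a\<in>M. (\<Sum>k<m. a k) = 0) \<or>
      (\<forall>i<m. \<forall>s\<in>{-1, 1}. \<exists>a\<in>M. two_term_form a s i 0 i) \<or>
      ((\<forall>a\<in>M. (\<Sum>k<m. a k) / 2 \<in> \<int>) \<and>
       (\<forall>i<m. \<forall>k<m. i \<noteq> k \<longrightarrow> (\<forall>s\<in>{-1, 1}. \<forall>t\<in>{-1, 1}. \<exists>a\<in>M. two_term_form a s i t k)))"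
  shows "\<exists>w. classical_coords \<Psi> m w"
proof -
  have supp: "\<forall>a\<in>M. \<forall>k\<ge>m. a k = 0"
  proof (intro ballI allI impI)
    fix a k assume a: "a \<in> M" and k: "k \<ge> m"
    obtain i j s t where ij: "i < m" "j < m" and "two_term_form a s i t j" using form[OF a] by blast
    then have "a k = of_int (s * of_bool (k = i) + t * of_bool (k = j))" by (simp add: two_term_form_def)
    then show "a k = 0" using k ij by simp
  qed
  obtain w where w: "\<And>k. w k \<in> span \<Psi>" "span \<Psi> \<subseteq> span (w ` {..<m})"
    and into: "\<And>\<alpha>. \<alpha> \<in> \<Psi> \<Longrightarrow> \<exists>a\<in>M. \<forall>k. \<alpha> \<bullet> w k = a k"
    and onto: "\<And>a. a \<in> M \<Longrightarrow> \<exists>\<alpha>\<in>\<Psi>. \<forall>k. \<alpha> \<bullet> w k = a k"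
    using isomorphic_model_coords[OF iso supp] by blast
  have rc: "root_coords m w \<alpha> s i t j" if "\<forall>k. \<alpha> \<bullet> w k = a k" "two_term_form a s i t j" for \<alpha> a s i t j
    using that by (simp add: root_coords_def two_term_form_def)
  have 1: "\<forall>\<alpha>\<in>\<Psi>. \<exists>i<m. \<exists>j<m. \<exists>s\<in>{-1, 0, 1}. \<exists>t\<in>{-1, 0, 1}. root_coords m w \<alpha> s i t j"
  proof
    fix \<alpha> assume "\<alpha> \<in> \<Psi>"
    then obtain a where a: "a \<in> M" "\<forall>k. \<alpha> \<bullet> w k = a k" using into by blast
    show "\<exists>i<m. \<exists>j<m. \<exists>s\<in>{-1, 0, 1}. \<exists>t\<in>{-1, 0, 1}. root_coords m w \<alpha> s i t j"
      using form[OF a(1)] rc[OF a(2)] by meson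
  qed
  have ex: "\<exists>\<beta>\<in>\<Psi>. root_coords m w \<beta> s i t j" if "\<exists>a\<in>M. two_term_form a s i t j" for s i t j
    using that onto rc by meson
  have sums: "\<forall>\<alpha>\<in>\<Psi>. Q (\<Sum>k<m. \<alpha> \<bullet> w k)" if "\<forall>a\<in>M. Q (\<Sum>k<m. a k)" for Q
  proof
    fix \<alpha> assume "\<alpha> \<in> \<Psi>"
    then obtain a where a: "a \<in> M" "\<forall>k. \<alpha> \<bullet> w k = a k" using into by blast
    then show "Q (\<Sum>k<m. \<alpha> \<bullet> w k)" using that by simp
  qed
  have 2: "(\<forall>\<alpha>\<in>\<Psi>. (\<Sum>k<m. \<alpha> \<bullet> w k) = 0) \<or>
      (\<forall>i<m. \<forall>s\<in>{-1, 1}. \<exists>\<beta>\<in>\<Psi>. root_coords m w \<beta> s i 0 i) \<or>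
      ((\<forall>\<alpha>\<in>\<Psi>. (\<Sum>k<m. \<alpha> \<bullet> w k) / 2 \<in> \<int>) \<and>
       (\<forall>i<m. \<forall>k<m. i \<noteq> k \<longrightarrow>
          (\<forall>s\<in>{-1, 1}. \<forall>t\<in>{-1, 1}. \<exists>\<beta>\<in>\<Psi>. root_coords m w \<beta> s i t k)))"
    using types
  proof (elim disjE)
    assume "\<forall>a\<in>M. (\<Sum>k<m. a k) = 0"
    from sums[OF this] show ?thesis by (rule disjI1)
  next
    assume "\<forall>i<m. \<forall>s\<in>{-1, 1}. \<exists>a\<in>M. two_term_form a s i 0 i"
    then show ?thesis using ex by (intro disjI2[OF disjI1]) simp
  next
    assume A: "(\<forall>a\<in>M. (\<Sum>k<m. a k) / 2 \<in> \<int>) \<and>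
       (\<forall>i<m. \<forall>k<m. i \<noteq> k \<longrightarrow> (\<forall>s\<in>{-1, 1}. \<forall>t\<in>{-1, 1}. \<exists>a\<in>M. two_term_form a s i t k))"
    show ?thesis
    proof (rule disjI2[OF disjI2], rule conjI)
      show "\<forall>\<alpha>\<in>\<Psi>. (\<Sum>k<m. \<alpha> \<bullet> w k) / 2 \<in> \<int>" using A by (intro sums[of "\<lambda>x. x / 2 \<in> \<int>"]) simp
    qed (use A ex in simp)
  qed
  show ?thesis unfolding classical_coords_def using w 1 2 by (intro exI[of _ w] conjI) simp_all
qed

lemma A_roots_form:
  assumes "a \<in> A_roots n"
  shows "\<exists>i<n+1. \<exists>j<n+1. two_term_form a 1 i (-1) j"
  using assms unfolding A_roots_def two_term_form_def eps_def by fastforce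

lemma D_roots_form:
  assumes "a \<in> D_roots n"
  shows "\<exists>i<n. \<exists>j<n. \<exists>s\<in>{-1, 1}. \<exists>t\<in>{-1, 1}. two_term_form a s i t j"
proof -
  obtain s t i j where a: "a = (\<lambda>k. s * eps i k + t * eps j k)" "s \<in> {1, -1}" "t \<in> {1, -1}" "i < j" "j < n"
    using assms unfolding D_roots_def by blast
  have "\<exists>s'\<in>{-1, 1::int}. s = of_int s'" "\<exists>t'\<in>{-1, 1::int}. t = of_int t'" using a by auto
  then obtain s' t' :: int where st: "s' \<in> {-1, 1}" "s = of_int s'" "t' \<in> {-1, 1}" "t = of_int t'" by blast
  have "two_term_form a s' i t' j" by (simp add: two_term_form_def a(1) st eps_def)
  then show ?thesis using a(4,5) st by (meson order.strict_trans)
qed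

lemma D_roots_contain:
  assumes "i < n" "k < n" "i \<noteq> k" "s \<in> {-1, 1}" "t \<in> {-1, 1}"
  shows "\<exists>a\<in>D_roots n. two_term_form a s i t k"
proof (cases "i < k")
  case True
  have "(\<lambda>l. of_int s * eps i l + of_int t * eps k l) \<in> D_roots n"
    unfolding D_roots_def mem_Collect_eq
    by (intro exI conjI, rule refl) (use assms True in auto)
  then show ?thesis by (rule bexI[rotated]) (simp add: two_term_form_def eps_def)
next
  case False
  have "(\<lambda>l. of_int t * eps k l + of_int s * eps i l) \<in> D_roots n"
    unfolding D_roots_def mem_Collect_eq
    by (intro exI conjI, rule refl) (use assms False in auto)
  then show ?thesis by (rule bexI[rotated]) (simp add: two_term_form_def eps_def)
qed

lemma two_term_form_sum:
  assumes "two_term_form a s i t j" "i < m" "j < m"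
  shows "(\<Sum>k<m. a k) = of_int (s + t)"
proof -
  have "(\<Sum>k<m. a k) = (\<Sum>k<m. (if k = i then of_int s else 0) + (if k = j then of_int t else 0))"
    by (rule sum.cong) (use assms(1) in \<open>auto simp: two_term_form_def\<close>)
  then show ?thesis using assms(2,3) by (simp add: sum.distrib)
qed

lemma D_roots_sum: "a \<in> D_roots n \<Longrightarrow> (\<Sum>k<n. a k) / 2 \<in> \<int>"
proof -
  assume "a \<in> D_roots n"
  then obtain i j s t where "i < n" "j < n" "s \<in> {-1, 1}" "t \<in> {-1, 1}" "two_term_form a s i t j"
    using D_roots_form by blast
  then show ?thesis using two_term_form_sum[of a s i t j n] by auto
qed

lemma classical_coords_exist:
  fixes \<Psi> :: "'a::euclidean_space set"
  assumes "classical_type \<Psi>"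
  shows "\<exists>m w. classical_coords \<Psi> m w"
  using assms unfolding classical_type_def
proof (elim disjE exE conjE)
  fix n assume iso: "isomorphic_to_model \<Psi> (n + 1) (A_roots n)"
  have "\<exists>w. classical_coords \<Psi> (n + 1) w"
  proof (rule classical_coords_of_model[OF iso])
    fix a assume a: "a \<in> A_roots n"
    from A_roots_form[OF a] show "\<exists>i<n+1. \<exists>j<n+1. \<exists>s\<in>{-1, 0, 1}. \<exists>t\<in>{-1, 0, 1}. two_term_form a s i t j"
      by blast
  next
    have "(\<Sum>k<n+1. a k) = 0" if "a \<in> A_roots n" for a
      using A_roots_form[OF that] two_term_form_sum[of a 1 _ "-1" _ "n+1"] by auto
    then show "(\<forall>a\<in>A_roots n. (\<Sum>k<n+1. a k) = 0) \<or>
      (\<forall>i<n+1. \<forall>s\<in>{-1, 1}. \<exists>a\<in>A_roots n. two_term_form a s i 0 i) \<or>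
      ((\<forall>a\<in>A_roots n. (\<Sum>k<n+1. a k) / 2 \<in> \<int>) \<and>
       (\<forall>i<n+1. \<forall>k<n+1. i \<noteq> k \<longrightarrow> (\<forall>s\<in>{-1, 1}. \<forall>t\<in>{-1, 1}. \<exists>a\<in>A_roots n. two_term_form a s i t k)))"
      by (intro disjI1 ballI)
  qed
  then show ?thesis by blast
next
  fix n assume iso: "isomorphic_to_model \<Psi> n (B_roots n)"
  have "\<exists>w. classical_coords \<Psi> n w"
  proof (rule classical_coords_of_model[OF iso])
    fix a assume "a \<in> B_roots n"
    then consider "a \<in> D_roots n" | s i where "a = (\<lambda>k. s * eps i k)" "s \<in> {1, -1}" "i < n"
      unfolding B_roots_def by blast
    then show "\<exists>i<n. \<exists>j<n. \<exists>s\<in>{-1, 0, 1}. \<exists>t\<in>{-1, 0, 1}. two_term_form a s i t j"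
    proof cases
      case 1
      from D_roots_form[OF this] show ?thesis by blast
    next
      case 2
      then have "two_term_form a 1 i 0 i \<or> two_term_form a (-1) i 0 i" by (auto simp: two_term_form_def eps_def)
      then show ?thesis using 2(3) by blast
    qed
  next
    have "\<exists>a\<in>B_roots n. two_term_form a s i 0 i" if "i < n" "s \<in> {-1, 1}" for s i
    proof (rule bexI)
      show "two_term_form (\<lambda>k. of_int s * eps i k) s i 0 i" by (simp add: two_term_form_def eps_def)
      show "(\<lambda>k. of_int s * eps i k) \<in> B_roots n"
        unfolding B_roots_def Un_iff mem_Collect_eq
        by (intro disjI2 exI conjI, rule refl) (use that in auto)
    qed
    then show "(\<forall>a\<in>B_roots n. (\<Sum>k<n. a k) = 0) \<or>
      (\<forall>i<n. \<forall>s\<in>{-1, 1}. \<exists>a\<in>B_roots n. two_term_form a s i 0 i) \<or>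
      ((\<forall>a\<in>B_roots n. (\<Sum>k<n. a k) / 2 \<in> \<int>) \<and>
       (\<forall>i<n. \<forall>k<n. i \<noteq> k \<longrightarrow> (\<forall>s\<in>{-1, 1}. \<forall>t\<in>{-1, 1}. \<exists>a\<in>B_roots n. two_term_form a s i t k)))"
      by (intro disjI2[OF disjI1] allI impI ballI)
  qed
  then show ?thesis by blast
next
  fix n assume iso: "isomorphic_to_model \<Psi> n (C_roots n)"
  have form: "a \<in> D_roots n \<or> (\<exists>i<n. \<exists>s\<in>{-1, 1}. two_term_form a s i s i)" if "a \<in> C_roots n" for a
  proof -
    have "a \<in> D_roots n \<or> (\<exists>s i. a = (\<lambda>k. 2 * s * eps i k) \<and> s \<in> {1, -1} \<and> i < n)"
      using that unfolding C_roots_def by blast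
    then show ?thesis
    proof (elim disjE exE conjE)
      fix s i assume *: "a = (\<lambda>k. 2 * s * eps i k)" "s \<in> {1, -1}" "i < n"
      then have "two_term_form a 1 i 1 i \<or> two_term_form a (-1) i (-1) i" by (auto simp: two_term_form_def eps_def)
      then show ?thesis using *(3) by blast
    qed blast
  qed
  have "\<exists>w. classical_coords \<Psi> n w"
  proof (rule classical_coords_of_model[OF iso])
    fix a assume "a \<in> C_roots n"
    from form[OF this] show "\<exists>i<n. \<exists>j<n. \<exists>s\<in>{-1, 0, 1}. \<exists>t\<in>{-1, 0, 1}. two_term_form a s i t j"
      using D_roots_form[of a n] by blast
  next
    have "(\<Sum>k<n. a k) / 2 \<in> \<int>" if "a \<in> C_roots n" for a
      using form[OF that] D_roots_sum[of a n] two_term_form_sum[of a _ _ _ _ n] by fastforce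
    moreover have "\<exists>a\<in>C_roots n. two_term_form a s i t k"
      if "i < n" "k < n" "i \<noteq> k" "s \<in> {-1, 1}" "t \<in> {-1, 1}" for s i t k
      using D_roots_contain[OF that] unfolding C_roots_def by blast
    ultimately show "(\<forall>a\<in>C_roots n. (\<Sum>k<n. a k) = 0) \<or>
      (\<forall>i<n. \<forall>s\<in>{-1, 1}. \<exists>a\<in>C_roots n. two_term_form a s i 0 i) \<or>
      ((\<forall>a\<in>C_roots n. (\<Sum>k<n. a k) / 2 \<in> \<int>) \<and>
       (\<forall>i<n. \<forall>k<n. i \<noteq> k \<longrightarrow> (\<forall>s\<in>{-1, 1}. \<forall>t\<in>{-1, 1}. \<exists>a\<in>C_roots n. two_term_form a s i t k)))"
      by (intro disjI2[OF disjI2] conjI allI impI ballI)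
  qed
  then show ?thesis by blast
next
  fix n assume iso: "isomorphic_to_model \<Psi> n (D_roots n)"
  have "\<exists>w. classical_coords \<Psi> n w"
  proof (rule classical_coords_of_model[OF iso])
    fix a assume "a \<in> D_roots n"
    from D_roots_form[OF this] show "\<exists>i<n. \<exists>j<n. \<exists>s\<in>{-1, 0, 1}. \<exists>t\<in>{-1, 0, 1}. two_term_form a s i t j"
      by blast
  next
    show "(\<forall>a\<in>D_roots n. (\<Sum>k<n. a k) = 0) \<or>
      (\<forall>i<n. \<forall>s\<in>{-1, 1}. \<exists>a\<in>D_roots n. two_term_form a s i 0 i) \<or>
      ((\<forall>a\<in>D_roots n. (\<Sum>k<n. a k) / 2 \<in> \<int>) \<and>
       (\<forall>i<n. \<forall>k<n. i \<noteq> k \<longrightarrow> (\<forall>s\<in>{-1, 1}. \<forall>t\<in>{-1, 1}. \<exists>a\<in>D_roots n. two_term_form a s i t k)))"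
      by (intro disjI2[OF disjI2] conjI allI impI ballI D_roots_sum D_roots_contain)
  qed
  then show ?thesis by blast
qed

section \<open>Local optimality\<close>

text \<open>
  Linear optimality over an integral M-convex polyhedron is decided by the adjacent roots.
\<close>
lemma root_neighbours_suffice:
  fixes \<Phi> :: "'a::euclidean_space set"
  assumes \<Phi>: "root_system \<Phi>" "\<forall>\<Psi>\<in>irreducible_components \<Phi>. classical_type \<Psi>"
    and P: "M_convex_polyhedron \<Phi> P" "integral_set \<Phi> P" and p: "p \<in> P" "p \<in> root_lattice \<Phi>"
    and c: "\<And>\<beta>. \<beta> \<in> \<Phi> \<Longrightarrow> p + \<beta> \<in> P \<Longrightarrow> c \<bullet> \<beta> \<le> 0" and r: "r \<in> P"
  shows "c \<bullet> r \<le> c \<bullet> p"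
proof -
  interpret based_M_polyhedron \<Phi> P p using P p by unfold_locales
  obtain \<Phi>' where \<Phi>': "\<Phi>' \<subseteq> \<Phi>" "tangent_cone p P = convex_cone hull \<Phi>'"
    using tangent_generators[OF p(1)] .
  have "c \<bullet> \<alpha> \<le> 0" if \<alpha>: "\<alpha> \<in> \<Phi>'" for \<alpha>
  proof -
    obtain \<Psi> where \<Psi>: "\<Psi> \<in> irreducible_components \<Phi>" "\<alpha> \<in> \<Psi>"
      using root_in_irreducible_component[OF \<Phi>(1)] \<alpha> \<Phi>'(1) by blast
    then obtain m w where mw: "classical_coords \<Psi> m w" using \<Phi>(2) classical_coords_exist by blast
    interpret based_M_polyhedron_component \<Phi> P p \<Psi> m w
      using \<Psi>(1) mw unfolding irreducible_components_def by unfold_locales auto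
    show ?thesis using tangent_root_of_component[OF c \<Phi>' \<alpha> \<Psi>(2)] .
  qed
  then show ?thesis using maximal_iff[OF p(1) \<Phi>'(2), of c] r by blast
qed

theorem theorem6p10:
  fixes \<Phi> :: "'a::euclidean_space set" and g :: "'a \<Rightarrow> ereal" and p :: 'a
  assumes "root_system \<Phi>" and "essential \<Phi>"
    and "\<forall>\<Psi>\<in>irreducible_components \<Phi>. classical_type \<Psi>"
    and "M_convex_fun \<Phi> g"
    and "p \<in> dom_on (root_lattice \<Phi>) g"
  shows "p \<in> argmin_on (root_lattice \<Phi>) g \<longleftrightarrow> (\<forall>\<alpha>\<in>\<Phi>. g p \<le> g (p + \<alpha>))"
proof
  have fin: "finite \<Phi>" using assms(1) by (simp add: root_system_def)
  have pL: "p \<in> root_lattice \<Phi>" using assms(5) by (simp add: dom_on_def)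
  have nb: "p + \<alpha> \<in> root_lattice \<Phi>" if "\<alpha> \<in> \<Phi>" for \<alpha> using root_in_lattice[OF fin that pL] .
  {
    assume "p \<in> argmin_on (root_lattice \<Phi>) g"
    then show "\<forall>\<alpha>\<in>\<Phi>. g p \<le> g (p + \<alpha>)" using nb by (simp add: argmin_on_def)
  }
  assume loc: "\<forall>\<alpha>\<in>\<Phi>. g p \<le> g (p + \<alpha>)"
  obtain h where h: "primal_integral_M_convex \<Phi> h" and gh: "\<And>q. q \<in> root_lattice \<Phi> \<Longrightarrow> g q = h q"
    using assms(4) unfolding M_convex_fun_def by blast
  have noninf: "\<And>u. h u \<noteq> -\<infinity>"
    and lp: "locally_polyhedral_convex_fun h"
    and fam: "\<And>P. P \<in> argmin_family h \<Longrightarrow> M_convex_polyhedron \<Phi> P \<and> integral_set \<Phi> P"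
    using h unfolding primal_integral_M_convex_def proper_def by auto
  have "\<bar>h p\<bar> \<noteq> \<infinity>" using assms(5) gh[OF pL] by (simp add: dom_on_def)
  then obtain a where a: "h p = ereal a" by (cases "h p") auto
  have "h p \<le> h q" for q
  proof (rule ccontr)
    assume "\<not> h p \<le> h q"
    then have "h q < h p" by simp
    from linear_descent_piece[OF lp noninf a this]
    obtain x r where p: "p \<in> argmin_on UNIV (\<lambda>u. h u - ereal (u \<bullet> x))"
      and r: "r \<in> argmin_on UNIV (\<lambda>u. h u - ereal (u \<bullet> x))" and lt: "h r < h p" by blast
    define P where "P = argmin_on UNIV (\<lambda>u. h u - ereal (u \<bullet> x))"
    have "P \<in> argmin_family h" unfolding argmin_family_def P_def using p by blast
    then have P: "M_convex_polyhedron \<Phi> P" "integral_set \<Phi> P" using fam by auto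
    \<comment> \<open>On \<open>P\<close> the function \<open>h\<close> is affine with slope \<open>x\<close>.\<close>
    have val: "\<exists>v. h u = ereal v \<and> v - a = (u - p) \<bullet> x" if "u \<in> P" for u
    proof -
      have "h u - ereal (u \<bullet> x) = h p - ereal (p \<bullet> x)"
        using that p unfolding P_def argmin_on_def by (auto intro: antisym)
      then show ?thesis using a by (cases "h u") (auto simp: inner_diff_left)
    qed
    have "(- x) \<bullet> r \<le> (- x) \<bullet> p"
    proof (rule root_neighbours_suffice[OF assms(1,3) P _ pL])
      show "p \<in> P" "r \<in> P" using p r by (auto simp: P_def)
      fix \<beta> assume \<beta>: "\<beta> \<in> \<Phi>" "p + \<beta> \<in> P"
      obtain v where v: "h (p + \<beta>) = ereal v" "v - a = \<beta> \<bullet> x" using val[OF \<beta>(2)] by auto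
      have "g p \<le> g (p + \<beta>)" using loc \<beta>(1) by blast
      then have "h p \<le> h (p + \<beta>)" using gh[OF pL] gh[OF nb[OF \<beta>(1)]] by simp
      then show "(- x) \<bullet> \<beta> \<le> 0" using a v by (simp add: inner_commute)
    qed
    moreover obtain v where "h r = ereal v" "v - a = (r - p) \<bullet> x" using val[of r] r by (auto simp: P_def)
    ultimately show False using lt a by (simp add: inner_diff_left inner_commute[of x])
  qed
  then show "p \<in> argmin_on (root_lattice \<Phi>) g" using gh pL by (auto simp: argmin_on_def)
qed

end
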